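(* Let $b$ be a (possibly degenerate) alternating bilinear form on an $n$-dimensional vector space $V$ over a field of characteristic different from $2$, with Witt index $\nu$ and rank $r$. Let $\mathcal{V}$ be a linear subspace of $\mathcal{A}_b$ consisting only of nilpotent endomorphisms, with $\dim\mathcal{V}=\binom{n-r}{2}+r(n-r)+(\nu-n+r)(n-\nu-1)$. Then there exists a maximal partially complete $b$-singular flag $\mathcal{F}=(F_0,\dots,F_\nu)$ of $V$ such that $F_{n-r}=\mathrm{Rad}(b)$ and $\mathcal{V}$ equals the set of all nilpotent $b$-alternating endomorphisms of $V$ that stabilize $\mathcal{F}$.
   Context: $\mathrm{Rad}(b)=\{y\in V:\forall x\in V,\ b(x,y)=0\}$. The Witt index of $b$ is the maximal dimension of a totally singular subspace $X$ ($b(x,y)=0$ for all $x,y\in X$). An endomorphism $u$ is $b$-alternating if $(x,y)\mapsto b(x,u(y))$ is alternating (vanishes on all $(x,x)$); $\mathcal{A}_b$ is the space of these. A flag $(F_0,\dots,F_p)$ is an increasing sequence of subspaces; it is partially complete if $\dim F_i=i$ for all $i$, $b$-singular if $F_p$ is totally singular, and maximal if moreover $p$ is the Witt index of $b$. $u$ stabilizes the flag if $u(F_i)\subseteq F_i$ for all $i$. *)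

theory Defs
  imports Complex_Main "HOL-Library.Function_Algebras"
begin

text \<open>Ambient setting: a vector space over the field 'k with scalar multiplication
  scale on the type 'v (the whole type is the space V). Endomorphisms are functions
  'v => 'v; they form a vector space under pointwise operations with scalar
  multiplication fun_scale.\<close>

definition fun_scale :: "('k \<Rightarrow> 'v \<Rightarrow> 'v) \<Rightarrow> 'k \<Rightarrow> ('v \<Rightarrow> 'v) \<Rightarrow> ('v \<Rightarrow> 'v)" where
  "fun_scale scale c f = (\<lambda>x. scale c (f x))"

definition bilinear_form ::
  "('k::field \<Rightarrow> 'v::ab_group_add \<Rightarrow> 'v) \<Rightarrow> ('v \<Rightarrow> 'v \<Rightarrow> 'k) \<Rightarrow> bool" where
  "bilinear_form scale b \<longleftrightarrow>
     (\<forall>x. Vector_Spaces.linear scale (*) (b x)) \<and>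
     (\<forall>y. Vector_Spaces.linear scale (*) (\<lambda>x. b x y))"

definition alternating_form :: "('v \<Rightarrow> 'v \<Rightarrow> 'k::zero) \<Rightarrow> bool" where
  "alternating_form b \<longleftrightarrow> (\<forall>x. b x x = 0)"

definition Rad :: "('v \<Rightarrow> 'v \<Rightarrow> 'k::zero) \<Rightarrow> 'v set" where
  "Rad b = {y. \<forall>x. b x y = 0}"

definition totally_singular :: "('v \<Rightarrow> 'v \<Rightarrow> 'k::zero) \<Rightarrow> 'v set \<Rightarrow> bool" where
  "totally_singular b X \<longleftrightarrow> (\<forall>x\<in>X. \<forall>y\<in>X. b x y = 0)"

definition witt_index ::
  "('k::field \<Rightarrow> 'v::ab_group_add \<Rightarrow> 'v) \<Rightarrow> ('v \<Rightarrow> 'v \<Rightarrow> 'k) \<Rightarrow> nat" where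
  "witt_index scale b =
     Max {vector_space.dim scale X | X. module.subspace scale X \<and> totally_singular b X}"

definition form_rank ::
  "('k::field \<Rightarrow> 'v::ab_group_add \<Rightarrow> 'v) \<Rightarrow> ('v \<Rightarrow> 'v \<Rightarrow> 'k) \<Rightarrow> nat" where
  "form_rank scale b = vector_space.dim scale (UNIV::'v set) - vector_space.dim scale (Rad b)"

definition b_alternating ::
  "('k::field \<Rightarrow> 'v::ab_group_add \<Rightarrow> 'v) \<Rightarrow> ('v \<Rightarrow> 'v \<Rightarrow> 'k) \<Rightarrow> ('v \<Rightarrow> 'v) \<Rightarrow> bool" where
  "b_alternating scale b u \<longleftrightarrow> Vector_Spaces.linear scale scale u \<and> (\<forall>x. b x (u x) = 0)"

definition nilpotent_endo :: "('v::zero \<Rightarrow> 'v) \<Rightarrow> bool" where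
  "nilpotent_endo u \<longleftrightarrow> (\<exists>k. (u ^^ k) = (\<lambda>_. 0))"

definition partially_complete_flag ::
  "('k::field \<Rightarrow> 'v::ab_group_add \<Rightarrow> 'v) \<Rightarrow> nat \<Rightarrow> (nat \<Rightarrow> 'v set) \<Rightarrow> bool" where
  "partially_complete_flag scale p F \<longleftrightarrow>
     (\<forall>i\<le>p. module.subspace scale (F i) \<and> vector_space.dim scale (F i) = i) \<and>
     (\<forall>i<p. F i \<subseteq> F (Suc i))"

definition stabilizes_flag :: "nat \<Rightarrow> (nat \<Rightarrow> 'v set) \<Rightarrow> ('v \<Rightarrow> 'v) \<Rightarrow> bool" where
  "stabilizes_flag p F u \<longleftrightarrow> (\<forall>i\<le>p. u ` F i \<subseteq> F i)"

end

theory Submission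
  imports Defs "Jordan_Normal_Form.Char_Poly"
begin

text \<open>
  For a maximal singular flag \<open>F\<close> through the radical, let \<open>N(F)\<close> be the space of alternating
  endomorphisms that map each term of \<open>F\<close> into the preceding one; these are exactly the nilpotent
  stabilizers of \<open>F\<close>, and \<open>dim N(F)\<close> is at most the prescribed dimension. Let \<open>V\<close> be the given
  space. Since sums and differences of elements of \<open>V\<close> are nilpotent, \<open>tr (u v) = tr (u\<^sup>2 v) = 0\<close>
  on \<open>V\<close>. An alternating endomorphism that is trace-orthogonal to \<open>N(F)\<close> stabilizes \<open>F\<close>; comparing
  dimensions in the trace pairing of \<open>V\<close> with \<open>N(F)\<close> shows that every element of \<open>N(F)\<close>
  trace-orthogonal to \<open>V\<close> lies in \<open>V\<close>. Choosing \<open>F\<close> adapted to a single \<open>v \<in> V\<close> gives \<open>v\<^sup>2 \<in> V\<close>. So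
  \<open>V\<close> is closed under the Jordan product, and by Jacobson's theorem on such spaces of nilpotent
  endomorphisms \<open>V \<subseteq> N(F)\<close> for a common flag \<open>F\<close>; equality holds by dimension.
\<close>

section \<open>Traces of products of nilpotent matrices\<close>

definition mat_trace :: "'a::comm_monoid_add mat \<Rightarrow> 'a" where
  "mat_trace A = (\<Sum>i<dim_row A. A $$ (i, i))"

definition nilpotent_mat :: "'a::semiring_1 mat \<Rightarrow> bool" where
  "nilpotent_mat A \<longleftrightarrow> (\<exists>k. A ^\<^sub>m k = 0\<^sub>m (dim_row A) (dim_row A))"

definition mat_pencil :: "'a::zero mat \<Rightarrow> 'a mat \<Rightarrow> 'a poly mat" where
  "mat_pencil A B = mat (dim_row A) (dim_col A) (\<lambda>ij. [:A $$ ij, B $$ ij:])"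

lemma mat_pencil_carrier [simp]: "A \<in> carrier_mat m n \<Longrightarrow> mat_pencil A B \<in> carrier_mat m n"
  by (simp add: mat_pencil_def)

lemma index_mat_pencil [simp]:
  "A \<in> carrier_mat m n \<Longrightarrow> i < m \<Longrightarrow> j < n \<Longrightarrow> mat_pencil A B $$ (i, j) = [:A $$ (i, j), B $$ (i, j):]"
  by (auto simp: mat_pencil_def)

lemma poly_det: "poly (det M) x = det (map_mat (\<lambda>p. poly p x) M)"
proof -
  have "comm_ring_hom (\<lambda>p. poly p x)" by unfold_locales auto
  then show ?thesis by (simp add: comm_ring_hom.hom_det)
qed

lemma coeff_1_prod_linear:
  fixes a c :: "'b \<Rightarrow> 'a::idom"
  shows "coeff (\<Prod>i\<in>I. [:a i, c i:]) 1 = (\<Sum>i\<in>I. c i * (\<Prod>j\<in>I - {i}. a j))"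
proof -
  have "coeff p 1 = poly (pderiv p) 0" for p :: "'a poly"
    by (simp add: poly_0_coeff_0 coeff_pderiv)
  then show ?thesis
    by (simp add: pderiv_prod poly_sum poly_prod pderiv_pCons mult.commute)
qed

lemma prod_replace_col:
  assumes P: "P \<in> carrier_mat n n" and Q: "Q \<in> carrier_mat n n"
    and p: "p permutes {0..<n}" and k: "k < n"
  shows "(\<Prod>j<n. replace_col P (col Q k) k $$ (p j, j)) =
    Q $$ (p k, k) * (\<Prod>j\<in>{..<n} - {k}. P $$ (p j, j))"
proof -
  have p_less: "p j < n" if "j < n" for j
    using permutes_in_image[OF p, of j] that by simp
  have "(\<Prod>j<n. replace_col P (col Q k) k $$ (p j, j)) =
      (\<Prod>j<n. if j = k then Q $$ (p k, k) else P $$ (p j, j))"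
    using P Q p_less k by (intro prod.cong) (auto simp: replace_col_def)
  also have "\<dots> = Q $$ (p k, k) * (\<Prod>j\<in>{..<n} - {k}. P $$ (p j, j))"
    using k by (simp add: prod.remove[of _ k])
  finally show ?thesis .
qed

lemma coeff_1_det_mat_pencil:
  fixes P Q :: "'a::idom mat"
  assumes P: "P \<in> carrier_mat n n" and Q: "Q \<in> carrier_mat n n"
  shows "coeff (det (mat_pencil P Q)) 1 = (\<Sum>k<n. det (replace_col P (col Q k) k))"
proof -
  let ?perms = "{p. p permutes {0..<n}}"
  have "coeff (det (mat_pencil P Q)) 1 =
      (\<Sum>p\<in>?perms. coeff (signof p * (\<Prod>j<n. mat_pencil P Q $$ (p j, j))) 1)"
    unfolding det_col[OF mat_pencil_carrier[OF P]] coeff_sum ..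
  also have "\<dots> = (\<Sum>p\<in>?perms. signof p * (\<Sum>k<n. \<Prod>j<n. replace_col P (col Q k) k $$ (p j, j)))"
  proof (intro sum.cong refl)
    fix p assume "p \<in> ?perms"
    then have p: "p permutes {0..<n}" by simp
    have "(\<Prod>j<n. mat_pencil P Q $$ (p j, j)) = (\<Prod>j<n. [:P $$ (p j, j), Q $$ (p j, j):])"
      using permutes_in_image[OF p] by (intro prod.cong) (auto simp: index_mat_pencil[OF P])
    moreover have "coeff (signof p * q) 1 = signof p * coeff q 1" for q :: "'a poly"
      by (cases p rule: sign_cases) simp_all
    ultimately show "coeff (signof p * (\<Prod>j<n. mat_pencil P Q $$ (p j, j))) 1 =
        signof p * (\<Sum>k<n. \<Prod>j<n. replace_col P (col Q k) k $$ (p j, j))"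
      by (simp add: coeff_1_prod_linear prod_replace_col[OF P Q p] del: One_nat_def)
  qed
  also have "\<dots> = (\<Sum>k<n. \<Sum>p\<in>?perms. signof p * (\<Prod>j<n. replace_col P (col Q k) k $$ (p j, j)))"
    unfolding sum_distrib_left by (rule sum.swap)
  also have "\<dots> = (\<Sum>k<n. det (replace_col P (col Q k) k))"
    using P by (intro sum.cong refl det_col[symmetric]) (simp add: replace_col_def)
  finally show ?thesis .
qed

lemma coeff_1_det_mat_pencil_right_inverse:
  fixes P Q G :: "'a::idom mat"
  assumes P: "P \<in> carrier_mat n n" and Q: "Q \<in> carrier_mat n n" and G: "G \<in> carrier_mat n n"
    and inverse: "P * G = 1\<^sub>m n"
  shows "coeff (det (mat_pencil P Q)) 1 = det P * mat_trace (G * Q)"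
proof -
  have "det (replace_col P (col Q k) k) = det P * (G * Q) $$ (k, k)" if k: "k < n" for k
  proof -
    have "P *\<^sub>v (G *\<^sub>v col Q k) = col Q k"
      using P Q G k inverse by (simp flip: assoc_mult_mat_vec)
    then show ?thesis
      using cramer_lemma_mat[OF P, of "G *\<^sub>v col Q k" k] Q G k by simp
  qed
  then show ?thesis
    using G
    by (simp add: coeff_1_det_mat_pencil[OF P Q] mat_trace_def sum_distrib_left del: One_nat_def)
qed

definition neumann_mat :: "nat \<Rightarrow> 'a::comm_ring_1 mat \<Rightarrow> 'a poly mat" where
  "neumann_mat k A = mat (dim_row A) (dim_col A) (\<lambda>ij. \<Sum>m<k. monom ((- 1) ^ m * (A ^\<^sub>m m) $$ ij) m)"

lemma neumann_mat_carrier [simp]: "A \<in> carrier_mat n n \<Longrightarrow> neumann_mat k A \<in> carrier_mat n n"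
  by (simp add: neumann_mat_def)

lemma coeff_neumann_mat:
  fixes A :: "'a::comm_ring_1 mat"
  assumes A: "A \<in> carrier_mat n n" and vanish: "A ^\<^sub>m k = 0\<^sub>m n n" and "i < n" and "j < n"
  shows "coeff (neumann_mat k A $$ (i, j)) m = (- 1) ^ m * (A ^\<^sub>m m) $$ (i, j)"
proof -
  have "A ^\<^sub>m (k + d) = 0\<^sub>m n n" for d
    using A vanish by (induction d) auto
  then have "A ^\<^sub>m m = 0\<^sub>m n n" if "\<not> m < k"
    using that by (metis le_Suc_ex not_le)
  then show ?thesis using assms by (auto simp: neumann_mat_def coeff_sum)
qed

lemma pow_mat_Suc_left:
  assumes A: "A \<in> carrier_mat n n"
  shows "A ^\<^sub>m Suc m = A * A ^\<^sub>m m"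
proof (induction m)
  case (Suc m)
  then show ?case using A by (simp add: assoc_mult_mat[of _ n n _ n _ n])
qed (use A in simp)

lemma mat_pencil_one_mult_neumann_mat:
  fixes A :: "'a::comm_ring_1 mat"
  assumes A: "A \<in> carrier_mat n n" and vanish: "A ^\<^sub>m k = 0\<^sub>m n n"
  shows "mat_pencil (1\<^sub>m n) A * neumann_mat k A = 1\<^sub>m n"
proof (rule eq_matI)
  fix i j assume "i < dim_row (1\<^sub>m n :: 'a poly mat)" "j < dim_col (1\<^sub>m n :: 'a poly mat)"
  then have ij: "i < n" "j < n" by simp_all
  define G where "G = neumann_mat k A"
  have G: "G \<in> carrier_mat n n" using A by (simp add: G_def)
  have entry: "(mat_pencil (1\<^sub>m n) A * G) $$ (i, j) =
      G $$ (i, j) + (\<Sum>l = 0..<n. [:0, A $$ (i, l):] * G $$ (l, j))"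
  proof -
    have "(mat_pencil (1\<^sub>m n) A * G) $$ (i, j) =
        (\<Sum>l = 0..<n. [:if i = l then 1 else 0, A $$ (i, l):] * G $$ (l, j))"
      using ij A G by (auto simp: scalar_prod_def mat_pencil_def intro!: sum.cong)
    also have "\<dots> =
        (\<Sum>l = 0..<n. (if i = l then G $$ (l, j) else 0) + [:0, A $$ (i, l):] * G $$ (l, j))"
      by (intro sum.cong) auto
    finally show ?thesis using ij by (simp add: sum.distrib)
  qed
  have coeff_G: "coeff (G $$ (l, j)) m = (- 1) ^ m * (A ^\<^sub>m m) $$ (l, j)" if "l < n" for l m
    using coeff_neumann_mat[OF A vanish that ij(2)] by (simp add: G_def)
  have "coeff ((mat_pencil (1\<^sub>m n) A * G) $$ (i, j)) m = coeff (1\<^sub>m n $$ (i, j)) m" for m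
  proof (cases m)
    case 0
    then show ?thesis unfolding entry using ij A by (simp add: coeff_sum coeff_G)
  next
    case (Suc l)
    have "(\<Sum>h = 0..<n. A $$ (i, h) * (A ^\<^sub>m l) $$ (h, j)) = (A ^\<^sub>m m) $$ (i, j)"
      using ij A Suc pow_mat_Suc_left[OF A, of l] by (simp add: scalar_prod_def del: pow_mat.simps)
    then show ?thesis
      unfolding entry using ij Suc
      by (simp add: coeff_sum coeff_G mult.left_commute del: pow_mat.simps flip: sum_distrib_left)
  qed
  then show "(mat_pencil (1\<^sub>m n) A * neumann_mat k A) $$ (i, j) = 1\<^sub>m n $$ (i, j)"
    by (simp add: poly_eq_iff G_def)
qed (use A in \<open>simp_all add: neumann_mat_def mat_pencil_def\<close>)

lemma poly_mat_pencil:
  fixes A B :: "'a::comm_ring_1 mat"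
  assumes "A \<in> carrier_mat n n" and "B \<in> carrier_mat n n"
  shows "map_mat (\<lambda>p. poly p x) (mat_pencil A B) = A + x \<cdot>\<^sub>m B"
  using assms by (intro eq_matI) (auto simp: mat_pencil_def)

lemma det_mat_pencil_one_nilpotent:
  fixes A :: "'a::field mat"
  assumes A: "A \<in> carrier_mat n n" and "nilpotent_mat A"
  shows "det (mat_pencil (1\<^sub>m n) A) = 1"
proof -
  let ?P = "mat_pencil (1\<^sub>m n) A"
  obtain k where "A ^\<^sub>m k = 0\<^sub>m n n" using assms by (auto simp: nilpotent_mat_def)
  then have "det ?P * det (neumann_mat k A) = 1"
    using mat_pencil_one_mult_neumann_mat[OF A] det_mult[of ?P n "neumann_mat k A"] A by simp
  then have "is_unit (det ?P)" by (metis dvdI)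
  then have "degree (det ?P) = 0" by (metis is_unit_iff_degree dvd_0_left zero_neq_one)
  then obtain c where c: "det ?P = [:c:]" by (rule degree_eq_zeroE)
  have "poly (det ?P) 0 = det (1\<^sub>m n + 0 \<cdot>\<^sub>m A)"
    using A by (simp add: poly_det poly_mat_pencil[of _ n])
  also have "1\<^sub>m n + 0 \<cdot>\<^sub>m A = 1\<^sub>m n" using A by (intro eq_matI) auto
  finally show ?thesis using c by (simp add: one_pCons)
qed

lemma coeff_poly_linear:
  fixes D :: "'a::comm_ring_1 poly poly"
  shows "coeff (poly D [:0, y:]) m = (\<Sum>j\<le>m. y ^ j * coeff (coeff D j) (m - j))"
proof (induction D arbitrary: m)
  case (pCons a D)
  show ?case
  proof (cases m)
    case (Suc k)
    have "(\<Sum>j\<le>Suc k. y ^ j * coeff (coeff (pCons a D) j) (Suc k - j))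
        = coeff a (Suc k) + y * (\<Sum>j\<le>k. y ^ j * coeff (coeff D j) (k - j))"
      by (subst sum.atMost_Suc_shift) (simp add: sum_distrib_left mult.assoc)
    then show ?thesis using Suc pCons.IH[of k] by simp
  qed simp
qed simp

text \<open>The polynomial \<open>det (1 + s A + t B)\<close> in \<open>t\<close> with coefficients in \<open>k[s]\<close>.\<close>

definition det_pencil2 :: "'a::field mat \<Rightarrow> 'a mat \<Rightarrow> 'a poly poly" where
  "det_pencil2 A B = det (mat_pencil (mat_pencil (1\<^sub>m (dim_row A)) A) (map_mat (\<lambda>b. [:b:]) B))"

context
  fixes A B :: "'a::field mat" and n :: nat
  assumes A: "A \<in> carrier_mat n n" and B: "B \<in> carrier_mat n n"
begin

lemma coeff_coeff_1_det_pencil2: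
  assumes nil: "nilpotent_mat A"
  shows "coeff (coeff (det_pencil2 A B) 1) m = (- 1) ^ m * mat_trace (A ^\<^sub>m m * B)"
proof -
  let ?P = "mat_pencil (1\<^sub>m n) A" and ?B = "map_mat (\<lambda>b. [:b:]) B"
  obtain k where k: "A ^\<^sub>m k = 0\<^sub>m n n" using nil A by (auto simp: nilpotent_mat_def)
  let ?G = "neumann_mat k A"
  have "coeff (det_pencil2 A B) 1 = det ?P * mat_trace (?G * ?B)"
    unfolding det_pencil2_def using A B k
    by (subst coeff_1_det_mat_pencil_right_inverse[of _ n _ ?G])
      (auto simp: mat_pencil_one_mult_neumann_mat)
  then have "coeff (coeff (det_pencil2 A B) 1) m =
      (\<Sum>i<n. \<Sum>j = 0..<n. coeff (?G $$ (i, j)) m * B $$ (j, i))"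
    using A B nil neumann_mat_carrier[OF A, of k]
    by (simp add: det_mat_pencil_one_nilpotent mat_trace_def scalar_prod_def coeff_sum mult.commute)
  then show ?thesis
    using A B
    by (simp add: coeff_neumann_mat[OF A k] mat_trace_def scalar_prod_def sum_distrib_left
        mult.assoc)
qed

lemma poly_det_pencil2:
  assumes "nilpotent_mat (A + y \<cdot>\<^sub>m B)"
  shows "poly (det_pencil2 A B) [:0, y:] = 1"
proof -
  have "map_mat (\<lambda>p. poly p [:0, y:]) (mat_pencil (mat_pencil (1\<^sub>m n) A) (map_mat (\<lambda>b. [:b:]) B)) =
      mat_pencil (1\<^sub>m n) (A + y \<cdot>\<^sub>m B)"
    using A B by (intro eq_matI) (auto simp: mat_pencil_def)
  then show ?thesis
    using det_mat_pencil_one_nilpotent[OF _ assms] A B by (simp add: det_pencil2_def poly_det)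
qed

lemma coeff_0_coeff_det_pencil2:
  assumes nil: "nilpotent_mat B" and j: "j > 0"
  shows "coeff (coeff (det_pencil2 A B) j) 0 = 0"
proof -
  interpret eval: comm_ring_hom "\<lambda>p::'a poly. poly p 0" by unfold_locales auto
  interpret eval_coeffs: map_poly_comm_ring_hom "\<lambda>p::'a poly. poly p 0" ..
  have "map_poly (\<lambda>p. poly p 0) [:p, q:] = [:poly p 0, poly q 0:]" for p q :: "'a poly"
    by (intro poly_eqI) (simp add: coeff_map_poly coeff_pCons split: nat.splits)
  then have "map_mat (map_poly (\<lambda>p. poly p 0))
        (mat_pencil (mat_pencil (1\<^sub>m n) A) (map_mat (\<lambda>b. [:b:]) B)) =
      mat_pencil (1\<^sub>m n) B"
    using A B by (intro eq_matI) (auto simp: mat_pencil_def)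
  then have "map_poly (\<lambda>p. poly p 0) (det_pencil2 A B) = 1"
    using A det_mat_pencil_one_nilpotent[OF B nil]
    by (simp add: det_pencil2_def flip: eval_coeffs.hom_det)
  then have "coeff (map_poly (\<lambda>p. poly p 0) (det_pencil2 A B)) j = 0" using j by simp
  then show ?thesis by (simp add: coeff_map_poly poly_0_coeff_0)
qed

text \<open>The traces of the cubes of \<open>A \<plusminus> B\<close> do not give the second identity in characteristic 3.\<close>

lemma mat_trace_mult_nilpotent:
  assumes char: "(2::'a) \<noteq> 0" and "nilpotent_mat A" and "nilpotent_mat B"
    and "nilpotent_mat (A + B)" and "nilpotent_mat (A - B)"
  shows "mat_trace (A * B) = 0" and "mat_trace (A * A * B) = 0"
proof -
  define d where "d j m = coeff (coeff (det_pencil2 A B) j) m" for j m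
  have "A + 1 \<cdot>\<^sub>m B = A + B" "A + (- 1) \<cdot>\<^sub>m B = A - B" "A + 0 \<cdot>\<^sub>m B = A"
    using A B by (auto intro!: eq_matI)
  then have eval: "poly (det_pencil2 A B) [:0, y:] = 1" if "y \<in> {0, 1, - 1}" for y
    using that assms by (intro poly_det_pencil2) auto
  have d0: "d 0 m = 0" if "m > 0" for m
    using eval[of 0] that by (simp add: d_def poly_0_coeff_0)
  have diagonal: "(\<Sum>j\<le>m. y ^ j * d j (m - j)) = 0" if "m > 0" "y \<in> {1, - 1}" for m y
    using eval[of y] that coeff_poly_linear[of "det_pencil2 A B" y m] by (simp add: d_def)
  have eliminate: "x = 0" if "x + y = 0" "- x + y = 0" for x y :: 'a
  proof -
    have "2 * x = (x + y) - (- x + y)" by simp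
    then show ?thesis using that char by simp
  qed
  have "d 1 1 + d 2 0 = 0" "- d 1 1 + d 2 0 = 0"
    using diagonal[of 2 1] diagonal[of 2 "- 1"] d0[of 2] by (simp_all add: numeral_2_eq_2)
  then have "d 1 1 = 0" by (rule eliminate)
  then show "mat_trace (A * B) = 0"
    using coeff_coeff_1_det_pencil2[of 1] assms A by (simp add: d_def)
  have "d 3 0 = 0" using coeff_0_coeff_det_pencil2[of 3] assms by (simp add: d_def)
  then have "d 1 2 + d 2 1 = 0" "- d 1 2 + d 2 1 = 0"
    using diagonal[of 3 1] diagonal[of 3 "- 1"] d0[of 3]
    by (simp_all add: numeral_3_eq_3 numeral_2_eq_2)
  then have "d 1 2 = 0" by (rule eliminate)
  then show "mat_trace (A * A * B) = 0"
    using coeff_coeff_1_det_pencil2[of 2] assms A by (simp add: d_def numeral_2_eq_2)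
qed

end

section \<open>Finite-dimensional subspaces and pairings\<close>

definition functional_on :: "('k::field \<Rightarrow> 'v::ab_group_add \<Rightarrow> 'v) \<Rightarrow> 'v set \<Rightarrow> ('v \<Rightarrow> 'k) \<Rightarrow> bool" where
  "functional_on scale V f \<longleftrightarrow>
     (\<forall>x\<in>V. \<forall>y\<in>V. f (x + y) = f x + f y) \<and> (\<forall>c. \<forall>x\<in>V. f (scale c x) = c * f x)"

definition bilinear_on ::
  "('k::field \<Rightarrow> 'v::ab_group_add \<Rightarrow> 'v) \<Rightarrow> ('k \<Rightarrow> 'w::ab_group_add \<Rightarrow> 'w) \<Rightarrow>
    'v set \<Rightarrow> 'w set \<Rightarrow> ('v \<Rightarrow> 'w \<Rightarrow> 'k) \<Rightarrow> bool" where
  "bilinear_on s1 s2 V W \<beta> \<longleftrightarrow>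
     (\<forall>y\<in>W. functional_on s1 V (\<lambda>x. \<beta> x y)) \<and> (\<forall>x\<in>V. functional_on s2 W (\<beta> x))"

definition finite_dim :: "('k::field \<Rightarrow> 'v::ab_group_add \<Rightarrow> 'v) \<Rightarrow> 'v set \<Rightarrow> bool" where
  "finite_dim scale V \<longleftrightarrow> (\<exists>B. finite B \<and> V \<subseteq> module.span scale B)"

context vector_space
begin

lemma finite_dim_subset: "finite_dim scale V \<Longrightarrow> W \<subseteq> V \<Longrightarrow> finite_dim scale W"
  unfolding finite_dim_def by blast

lemma finite_dim_basis_exists:
  assumes "subspace V" and "finite_dim scale V"
  shows "\<exists>C. finite C \<and> independent C \<and> C \<subseteq> V \<and> span C = V \<and> card C = dim V"
proof -
  obtain B where B: "finite B" "V \<subseteq> span B" using assms(2) by (auto simp: finite_dim_def)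
  obtain C where C: "C \<subseteq> V" "independent C" "V \<subseteq> span C" "card C = dim V"
    using basis_exists[of V] by metis
  have "finite C" using independent_span_bound[OF B(1) C(2)] C(1) B(2) by auto
  moreover have "span C = V" using C assms(1) by (simp add: span_minimal subset_antisym)
  ultimately show ?thesis using C by blast
qed

lemma independent_card_le_finite_dim:
  assumes "subspace V" and "finite_dim scale V" and "independent C" and "C \<subseteq> V"
  shows "finite C" and "card C \<le> dim V"
proof -
  obtain D where D: "finite D" "span D = V" "card D = dim V"
    using finite_dim_basis_exists[OF assms(1,2)] by blast
  then show "finite C" "card C \<le> dim V"
    using independent_span_bound[OF D(1) assms(3)] assms(4) by auto
qed

lemma dim_subset_finite_dim:
  assumes "subspace V" and "finite_dim scale V" and "subspace W" and "W \<subseteq> V"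
  shows "dim W \<le> dim V"
proof -
  obtain C where "independent C" "C \<subseteq> W" "card C = dim W"
    using finite_dim_basis_exists[OF assms(3) finite_dim_subset[OF assms(2,4)]] by blast
  then show ?thesis using independent_card_le_finite_dim[OF assms(1,2), of C] assms(4) by auto
qed

lemma subspace_eq_of_dim_le:
  assumes V: "subspace V" "finite_dim scale V" and W: "subspace W" "W \<subseteq> V" and dim: "dim V \<le> dim W"
  shows "W = V"
proof (rule ccontr)
  assume "W \<noteq> V"
  then obtain x where x: "x \<in> V" "x \<notin> W" using W by blast
  obtain C where C: "finite C" "independent C" "C \<subseteq> W" "span C = W" "card C = dim W"
    using finite_dim_basis_exists[OF W(1) finite_dim_subset[OF V(2) W(2)]] by blast
  have "independent (insert x C)" using C x independent_insertI by auto
  moreover have "insert x C \<subseteq> V" using C x W by auto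
  ultimately have "card (insert x C) \<le> dim V"
    using independent_card_le_finite_dim[OF V] by blast
  moreover have "x \<notin> C" using C x by auto
  ultimately show False using C dim by simp
qed

lemma maximal_subspace_exists:
  assumes V: "subspace V" "finite_dim scale V" and "U\<^sub>0 \<in> \<U>"
    and \<U>: "\<And>U. U \<in> \<U> \<Longrightarrow> subspace U \<and> U \<subseteq> V"
  shows "\<exists>U\<in>\<U>. \<forall>W\<in>\<U>. U \<subseteq> W \<longrightarrow> W = U"
proof -
  obtain U where U: "U \<in> \<U>" and dim_max: "\<And>W. W \<in> \<U> \<Longrightarrow> dim W \<le> dim U"
    using ex_has_greatest_nat[of "\<lambda>U. U \<in> \<U>" U\<^sub>0 dim "Suc (dim V)"] \<open>U\<^sub>0 \<in> \<U>\<close>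
      dim_subset_finite_dim[OF V] \<U> by (auto simp: less_Suc_eq_le)
  have "W = U" if W: "W \<in> \<U>" "U \<subseteq> W" for W
    using subspace_eq_of_dim_le[of W U] dim_max[OF W(1)] \<U>[OF W(1)] \<U>[OF U] W(2)
      finite_dim_subset[OF V(2)] by blast
  with U show ?thesis by blast
qed

lemma complement_exists:
  assumes V: "subspace V" "finite_dim scale V" and W: "subspace W" "W \<subseteq> V"
  shows "\<exists>J. finite J \<and> J \<subseteq> V \<and> V \<subseteq> span (W \<union> J) \<and> card J + dim W = dim V"
proof -
  obtain C where C: "finite C" "independent C" "C \<subseteq> W" "span C = W" "card C = dim W"
    using finite_dim_basis_exists[OF W(1) finite_dim_subset[OF V(2) W(2)]] by blast
  obtain D where D: "C \<subseteq> D" "D \<subseteq> V" "independent D" "V \<subseteq> span D"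
    using maximal_independent_subset_extend[of C V] C W(2) by (metis subset_trans)
  have finite_D: "finite D" using independent_card_le_finite_dim[OF V D(3,2)] by simp
  have "card D = dim V" using basis_card_eq_dim D by blast
  then have "card (D - C) + dim W = dim V"
    using C D card_mono[OF finite_D D(1)] by (simp add: card_Diff_subset)
  moreover have "V \<subseteq> span (W \<union> (D - C))"
    using D(4) C(3) span_mono[of D "W \<union> (D - C)"] by blast
  ultimately show ?thesis using finite_D D by (intro exI[of _ "D - C"]) auto
qed

lemma functional_on_zero:
  "subspace V \<Longrightarrow> functional_on scale V f \<Longrightarrow> f 0 = 0"
  unfolding functional_on_def using subspace_0 scale_zero_left by (metis mult_zero_left)

lemma functional_on_subset:
  "functional_on scale V f \<Longrightarrow> W \<subseteq> V \<Longrightarrow> functional_on scale W f"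
  unfolding functional_on_def by blast

lemma subspace_functional_kernel:
  "subspace V \<Longrightarrow> functional_on scale V f \<Longrightarrow> subspace {x \<in> V. f x = 0}"
  using functional_on_zero[of V f] unfolding subspace_def functional_on_def by auto

lemma subspace_common_kernel:
  assumes V: "subspace V" and "\<And>i. i \<in> I \<Longrightarrow> functional_on scale V (f i)"
  shows "subspace {x \<in> V. \<forall>i\<in>I. f i x = 0}"
proof -
  have "{x \<in> V. \<forall>i\<in>I. f i x = 0} = (\<Inter>i\<in>I. {x \<in> V. f i x = 0}) \<inter> V" by auto
  then show ?thesis
    using assms by (auto intro!: subspace_inter subspace_Int subspace_functional_kernel)
qed

lemma dim_le_Suc_dim_kernel:
  assumes V: "subspace V" "finite_dim scale V" and f: "functional_on scale V f"
  shows "dim V \<le> Suc (dim {x \<in> V. f x = 0})"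
proof (cases "{x \<in> V. f x = 0} = V")
  case False
  let ?K = "{x \<in> V. f x = 0}"
  obtain x where x: "x \<in> V" "f x \<noteq> 0" using False by auto
  obtain C where C: "finite C" "span C = ?K" "card C = dim ?K"
    using finite_dim_basis_exists[OF subspace_functional_kernel[OF V(1) f]]
      finite_dim_subset[OF V(2), of ?K] by auto
  have "V \<subseteq> span (insert x C)"
  proof
    fix y assume y: "y \<in> V"
    let ?c = "f y / f x"
    have cx: "(- ?c) *s x \<in> V" using V x subspace_scale by blast
    then have "f (y + (- ?c) *s x) = f y + (- ?c) * f x"
      using f x y unfolding functional_on_def by metis
    then have "y + (- ?c) *s x \<in> ?K" using x(2) subspace_add[OF V(1) y cx] by simp
    then show "y \<in> span (insert x C)" unfolding span_insert C(2) by auto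
  qed
  then have "dim V \<le> card (insert x C)" using dim_le_card C(1) by simp
  also have "\<dots> \<le> Suc (dim ?K)" using C by (simp add: card_insert_if)
  finally show ?thesis .
qed simp

lemma dim_le_card_plus_dim_common_kernel:
  assumes "finite I" and V: "subspace V" "finite_dim scale V"
    and "\<And>i. i \<in> I \<Longrightarrow> functional_on scale V (f i)"
  shows "dim V \<le> card I + dim {x \<in> V. \<forall>i\<in>I. f i x = 0}"
  using assms(1,4)
proof (induction I rule: finite_induct)
  case (insert j I)
  let ?K = "{x \<in> V. \<forall>i\<in>I. f i x = 0}"
  have K: "subspace ?K" "finite_dim scale ?K" "functional_on scale ?K (f j)"
    using insert.prems V
    by (auto intro: subspace_common_kernel finite_dim_subset functional_on_subset)
  have "{x \<in> V. \<forall>i\<in>insert j I. f i x = 0} = {x \<in> ?K. f j x = 0}" by auto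
  then show ?case using dim_le_Suc_dim_kernel[OF K] insert by auto
qed simp

lemma separating_functional_exists:
  assumes S: "subspace S" and x: "x \<notin> S"
  obtains \<phi> where "Vector_Spaces.linear scale (*) \<phi>" and "\<phi> x = 1" and "\<And>y. y \<in> S \<Longrightarrow> \<phi> y = 0"
proof -
  interpret functional: vector_space_pair scale "(*)"
    by unfold_locales (auto simp: algebra_simps)
  obtain C where C: "C \<subseteq> S" "independent C" "S \<subseteq> span C"
    using basis_exists[of S] by metis
  then have span_C: "span C = S" using S span_minimal by blast
  then have "independent (insert x C)" using C x independent_insertI by simp
  then obtain \<phi> where \<phi>: "Vector_Spaces.linear scale (*) \<phi>"
      "\<forall>y\<in>insert x C. \<phi> y = (if y = x then 1 else 0)"
    using functional.linear_independent_extend[of "insert x C" "\<lambda>y. if y = x then 1 else 0"]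
    by blast
  then have "\<phi> y = 0" if "y \<in> C" for y using that x C by auto
  then have "\<phi> y = 0" if "y \<in> S" for y
    using functional.linear_eq_0_on_span[OF \<phi>(1), of C y] that span_C by auto
  then show ?thesis using that[of \<phi>] \<phi> by simp
qed

end

lemma bilinear_on_dim_le:
  assumes vs: "vector_space s1" "vector_space s2"
    and V: "module.subspace s1 V" "finite_dim s1 V"
    and W: "module.subspace s2 W" "finite_dim s2 W"
    and \<beta>: "bilinear_on s1 s2 V W \<beta>"
  shows "vector_space.dim s1 V + vector_space.dim s2 {y \<in> W. \<forall>x\<in>V. \<beta> x y = 0}
    \<le> vector_space.dim s2 W + vector_space.dim s1 {x \<in> V. \<forall>y\<in>W. \<beta> x y = 0}"
proof -
  interpret v1: vector_space s1 by fact
  interpret v2: vector_space s2 by fact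
  let ?R = "{y \<in> W. \<forall>x\<in>V. \<beta> x y = 0}"
  have functionals: "\<And>y. y \<in> W \<Longrightarrow> functional_on s1 V (\<lambda>x. \<beta> x y)"
    "\<And>x. x \<in> V \<Longrightarrow> functional_on s2 W (\<beta> x)"
    using \<beta> by (auto simp: bilinear_on_def)
  have R: "v2.subspace ?R" using v2.subspace_common_kernel[OF W(1) functionals(2)] .
  obtain J where J: "finite J" "J \<subseteq> W" "W \<subseteq> v2.span (?R \<union> J)" "card J + v2.dim ?R = v2.dim W"
    using v2.complement_exists[OF W R] by blast
  have "\<beta> x y = 0" if x: "x \<in> V" "\<forall>y\<in>J. \<beta> x y = 0" and y: "y \<in> W" for x y
  proof -
    have "?R \<union> J \<subseteq> {y \<in> W. \<beta> x y = 0}" using x J by auto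
    then have "v2.span (?R \<union> J) \<subseteq> {y \<in> W. \<beta> x y = 0}"
      using v2.subspace_functional_kernel[OF W(1) functionals(2)[OF x(1)]] by (rule v2.span_minimal)
    then show ?thesis using J(3) y by auto
  qed
  then have "{x \<in> V. \<forall>y\<in>W. \<beta> x y = 0} = {x \<in> V. \<forall>y\<in>J. \<beta> x y = 0}" using J(2) by auto
  then have "v1.dim V \<le> card J + v1.dim {x \<in> V. \<forall>y\<in>W. \<beta> x y = 0}"
    using v1.dim_le_card_plus_dim_common_kernel[OF J(1) V functionals(1)[OF subsetD[OF J(2)]]]
    by simp
  then show ?thesis using J(4) by simp
qed

lemma (in vector_space) right_kernel_subset_of_dim_le:
  assumes V: "subspace V" "finite_dim scale V" and W: "subspace W" "finite_dim scale W"
    and \<beta>: "bilinear_on scale scale V W \<beta>" and dim: "dim W \<le> dim V"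
    and left_le_right: "{x \<in> V. \<forall>y\<in>W. \<beta> x y = 0} \<subseteq> {y \<in> W. \<forall>x\<in>V. \<beta> x y = 0}" (is "?L \<subseteq> ?R")
  shows "{y \<in> W. \<forall>x\<in>V. \<beta> x y = 0} \<subseteq> V"
proof -
  have "dim V + dim ?R \<le> dim W + dim ?L"
    using bilinear_on_dim_le[OF _ _ V W \<beta>] vector_space_axioms by blast
  then have "dim ?R \<le> dim ?L" using dim by simp
  moreover have "subspace ?L" "subspace ?R"
    using V(1) W(1) \<beta> by (auto intro!: subspace_common_kernel simp: bilinear_on_def)
  moreover have "finite_dim scale ?R" by (rule finite_dim_subset[OF W(2)]) auto
  ultimately have "?L = ?R" using subspace_eq_of_dim_le left_le_right by blast
  then show ?thesis by blast
qed

lemma partially_complete_flag_mono: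
  assumes flag: "partially_complete_flag scale p F" and "i \<le> j" "j \<le> p"
  shows "F i \<subseteq> F j"
  using assms(2,3)
proof (induction rule: dec_induct)
  case (step k)
  then have "F k \<subseteq> F (Suc k)" using flag by (simp add: partially_complete_flag_def)
  then show ?case using step by auto
qed simp

context finite_dimensional_vector_space
begin

lemma finite_dim_all: "finite_dim scale V"
  unfolding finite_dim_def using finite_Basis span_Basis by blast

lemma subspace_eq_span_insert:
  assumes "subspace S" and "subspace T" and "S \<subseteq> T" and "dim T = Suc (dim S)"
    and "x \<in> T" and "x \<notin> S"
  shows "T = span (insert x S)"
proof -
  have "x \<notin> span S" using assms(1,6) span_minimal[of S S] by auto
  then have "dim (span (insert x S)) = dim T"
    using dim_insert[of x S] assms by simp
  then show ?thesis
    using subspace_dim_equal[OF subspace_span assms(2) span_minimal[OF _ assms(2)], of "insert x S"]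
      assms by simp
qed

lemma partially_complete_flag_0:
  assumes "partially_complete_flag scale p F"
  shows "F 0 = {0}"
proof -
  have "subspace (F 0)" "dim (F 0) = 0" using assms by (simp_all add: partially_complete_flag_def)
  then show ?thesis using subspace_0[of "F 0"] by auto
qed

definition adapted_basis :: "nat \<Rightarrow> (nat \<Rightarrow> 'b set) \<Rightarrow> (nat \<Rightarrow> 'b) \<Rightarrow> bool" where
  "adapted_basis p F e \<longleftrightarrow>
     inj_on e {..<p} \<and> independent (e ` {..<p}) \<and> (\<forall>k\<le>p. span (e ` {..<k}) = F k)"

lemma adapted_basis_exists:
  assumes flag: "partially_complete_flag scale p F"
  shows "\<exists>e. adapted_basis p F e"
proof -
  have F: "subspace (F i)" "dim (F i) = i" if "i \<le> p" for i
    using flag that by (auto simp: partially_complete_flag_def)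
  have step: "F i \<subset> F (Suc i)" if "i < p" for i
    using flag that F(2)[of i] F(2)[of "Suc i"] unfolding partially_complete_flag_def by fastforce
  then have "\<exists>x. x \<in> F (Suc i) - F i" if "i < p" for i using that by blast
  then obtain e where e: "\<And>i. i < p \<Longrightarrow> e i \<in> F (Suc i) - F i" by metis
  have span_e: "span (e ` {..<k}) = F k" if "k \<le> p" for k
    using that
  proof (induction k)
    case 0
    then show ?case using F[of 0] subspace_0 by auto
  next
    case (Suc k)
    then have "F (Suc k) = span (insert (e k) (F k))"
      using F[of k] F[of "Suc k"] step[of k] e[of k] by (intro subspace_eq_span_insert) auto
    also have "\<dots> = span (insert (e k) (span (e ` {..<k})))" using Suc by simp
    also have "\<dots> = span (e ` {..<Suc k})" by (simp add: span_insert span_span lessThan_Suc)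
    finally show ?case ..
  qed
  have "p \<le> card (e ` {..<p})"
    using dim_le_card[of "F p" "e ` {..<p}"] span_e[of p] F(2)[of p] by simp
  then have card_e: "card (e ` {..<p}) = p" using card_image_le[of "{..<p}" e] by simp
  then have "inj_on e {..<p}" by (intro eq_card_imp_inj_on) auto
  moreover have "independent (e ` {..<p})"
    by (rule card_le_dim_spanning[of _ "F p"])
      (use span_e[of p] F(2)[of p] span_superset[of "e ` {..<p}"] card_e in auto)
  ultimately show ?thesis using span_e unfolding adapted_basis_def by blast
qed

lemma adapted_basis_mem:
  assumes "adapted_basis p F e" and "j < p"
  shows "e j \<in> F (Suc j)"
  using assms span_base[of "e j" "e ` {..<Suc j}"] by (auto simp: adapted_basis_def Suc_le_eq)

lemma representation_adapted_basis_eq_0: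
  assumes e: "adapted_basis p F e" and k: "k \<le> i" "i < p" and x: "x \<in> F k"
  shows "representation (e ` {..<p}) x (e i) = 0"
proof -
  have "representation (e ` {..<p}) x = representation (e ` {..<k}) x"
    using e k x by (intro representation_extend) (auto simp: adapted_basis_def)
  moreover have "e i \<notin> e ` {..<k}"
    using e k inj_onD[of e "{..<p}" i] by (fastforce simp: adapted_basis_def)
  ultimately show ?thesis using representation_ne_zero by metis
qed

lemma eq_0_of_representation_adapted_basis:
  assumes e: "adapted_basis p F e" and x: "x \<in> F p"
    and "\<And>i. i < p \<Longrightarrow> representation (e ` {..<p}) x (e i) = 0"
  shows "x = 0"
proof -
  have "x = (\<Sum>v\<in>e ` {..<p}. representation (e ` {..<p}) x v *s v)"
    using sum_representation_eq[of "e ` {..<p}" x "e ` {..<p}"] e x by (simp add: adapted_basis_def)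
  also have "\<dots> = 0" using assms(3) by (intro sum.neutral) auto
  finally show ?thesis .
qed

end

section \<open>Jordan-closed spaces of nilpotent endomorphisms\<close>

lemma vector_space_fun_scale:
  assumes "vector_space scale"
  shows "vector_space (fun_scale scale)"
proof -
  interpret vector_space scale by fact
  show ?thesis
    by unfold_locales
      (auto simp: fun_scale_def fun_eq_iff scale_right_distrib scale_left_distrib)
qed

lemma sum_fun_apply: "(\<Sum>i\<in>I. f i) x = (\<Sum>i\<in>I. f i x :: 'b::comm_monoid_add)"
  by (induction I rule: infinite_finite_induct) auto

definition anticommutator :: "('v::ab_group_add \<Rightarrow> 'v) \<Rightarrow> ('v \<Rightarrow> 'v) \<Rightarrow> 'v \<Rightarrow> 'v" where
  "anticommutator u v = (u \<circ> v) + (v \<circ> u)"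

lemma nilpotent_escape:
  assumes nil: "nilpotent_endo u" and x: "x \<in> X" "x \<notin> S" and "0 \<in> S" and stable: "u ` X \<subseteq> X"
  obtains y where "y \<in> X" and "y \<notin> S" and "u y \<in> S"
proof -
  obtain k where k: "u ^^ k = (\<lambda>_. 0)" using nil by (auto simp: nilpotent_endo_def)
  define m where "m = (LEAST j. (u ^^ j) x \<in> S)"
  have "(u ^^ m) x \<in> S" unfolding m_def by (rule LeastI[of _ k]) (simp add: k \<open>0 \<in> S\<close>)
  moreover from this obtain j where j: "m = Suc j" using x by (cases m) auto
  moreover have "(u ^^ j) x \<notin> S" using not_less_Least[of j "\<lambda>j. (u ^^ j) x \<in> S"] j m_def by simp
  moreover have "(u ^^ j) x \<in> X" for j using x stable by (induction j) auto
  ultimately show ?thesis using that[of "(u ^^ j) x"] by simp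
qed

locale endomorphism_space = finite_dimensional_vector_space scale Basis
  for scale :: "'k::field \<Rightarrow> 'v::ab_group_add \<Rightarrow> 'v" (infixr \<open>*s\<close> 75) and Basis :: "'v set"
begin

sublocale E: vector_space "fun_scale scale"
  by (rule vector_space_fun_scale) unfold_locales

sublocale endo: vector_space_pair scale scale
  by unfold_locales

sublocale coord: Vector_Spaces.linear scale "(*)" "\<lambda>x. representation Basis x e" for e
  by (rule linear_representation[OF independent_Basis span_Basis])

abbreviation lin :: "('v \<Rightarrow> 'v) \<Rightarrow> bool" where
  "lin \<equiv> Vector_Spaces.linear scale scale"

lemma linI:
  assumes "\<And>x y. u (x + y) = u x + u y" and "\<And>c x. u (c *s x) = c *s u x"
  shows "lin u"
  unfolding Vector_Spaces.linear_iff using assms vector_space_axioms by blast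

lemma lin_funpow: "lin u \<Longrightarrow> lin (u ^^ k)"
  by (induction k) (auto intro: Vector_Spaces.linear_compose simp: linear_id)

lemma sum_coord: "(\<Sum>e\<in>Basis. representation Basis x e *s e) = x"
  using sum_representation_eq[OF independent_Basis _ finite_Basis subset_refl, of x] span_Basis
  by simp

lemma lin_expand:
  assumes u: "lin u"
  shows "u x = (\<Sum>e\<in>Basis. representation Basis x e *s u e)"
  using endo.linear_sum[OF u, of "\<lambda>e. representation Basis x e *s e" Basis]
  by (simp add: sum_coord endo.linear_scale[OF u])

lemma subspace_lin: "E.subspace {u. lin u}"
  unfolding E.subspace_def
  by (auto simp: Vector_Spaces.linear_iff vector_space_axioms fun_scale_def algebra_simps)

lemma finite_dim_lin: "finite_dim (fun_scale scale) {u. lin u}"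
proof -
  let ?r = "representation Basis"
  let ?unit = "\<lambda>(d, e) x. ?r x d *s e"
  have "u \<in> E.span (?unit ` (Basis \<times> Basis))" if u: "lin u" for u
  proof -
    have "u = (\<Sum>d\<in>Basis. \<Sum>e\<in>Basis. fun_scale scale (?r (u d) e) (?unit (d, e)))"
    proof
      fix x
      have "u x = (\<Sum>d\<in>Basis. ?r x d *s (\<Sum>e\<in>Basis. ?r (u d) e *s e))"
        unfolding sum_coord by (rule lin_expand[OF u])
      then show "u x = (\<Sum>d\<in>Basis. \<Sum>e\<in>Basis. fun_scale scale (?r (u d) e) (?unit (d, e))) x"
        by (simp add: sum_fun_apply fun_scale_def scale_sum_right mult.commute)
    qed
    moreover have "\<dots> \<in> E.span (?unit ` (Basis \<times> Basis))"
      by (intro E.span_sum E.span_scale E.span_base) auto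
    ultimately show ?thesis by simp
  qed
  then show ?thesis
    unfolding finite_dim_def using finite_Basis by (intro exI[of _ "?unit ` (Basis \<times> Basis)"]) auto
qed

lemma finite_dim_lin_subset: "(\<And>u. u \<in> V \<Longrightarrow> lin u) \<Longrightarrow> finite_dim (fun_scale scale) V"
  by (rule E.finite_dim_subset[OF finite_dim_lin]) auto

lemma image_span_insert_subset:
  assumes "lin u" and "subspace S" and "u ` S \<subseteq> S" and "u x \<in> S"
  shows "u ` span (insert x S) \<subseteq> S"
proof -
  have "u ` span (insert x S) = span (insert (u x) (u ` S))"
    by (simp flip: endo.linear_span_image[OF assms(1)])
  also have "\<dots> \<subseteq> S" using assms by (intro span_minimal) auto
  finally show ?thesis .
qed

text \<open>Stated for all subquotients \<open>T / S\<close>, so that a common flag can be refined between any two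
  stable subspaces.\<close>

definition strictly_triangularizable :: "('v \<Rightarrow> 'v) set \<Rightarrow> bool" where
  "strictly_triangularizable U \<longleftrightarrow>
     (\<forall>S T. subspace S \<and> subspace T \<and> S \<subset> T \<and> (\<forall>u\<in>U. u ` S \<subseteq> S \<and> u ` T \<subseteq> T)
        \<longrightarrow> (\<exists>x\<in>T - S. \<forall>u\<in>U. u x \<in> S))"

lemma strictly_triangularizableD:
  assumes "strictly_triangularizable U" and "subspace S" and "subspace T" and "S \<subset> T"
    and "\<And>u. u \<in> U \<Longrightarrow> u ` S \<subseteq> S" and "\<And>u. u \<in> U \<Longrightarrow> u ` T \<subseteq> T"
  shows "\<exists>x\<in>T - S. \<forall>u\<in>U. u x \<in> S"
  using assms unfolding strictly_triangularizable_def by simp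

lemma strictly_triangularizable_empty: "strictly_triangularizable {}"
  unfolding strictly_triangularizable_def by blast

lemma strictly_triangularizable_insert:
  assumes U: "strictly_triangularizable U" and v: "nilpotent_endo v"
    and anti: "\<And>u. u \<in> U \<Longrightarrow> anticommutator u v \<in> U"
  shows "strictly_triangularizable (insert v U)"
  unfolding strictly_triangularizable_def
proof (intro allI impI, elim conjE)
  fix S T assume ST: "subspace S" "subspace T" "S \<subset> T"
    and stable: "\<forall>u\<in>insert v U. u ` S \<subseteq> S \<and> u ` T \<subseteq> T"
  let ?X = "{x \<in> T. \<forall>u\<in>U. u x \<in> S}"
  obtain x where x: "x \<in> ?X" "x \<notin> S"
    using strictly_triangularizableD[OF U ST] stable by auto
  have "v ` ?X \<subseteq> ?X"
  proof (intro image_subsetI CollectI conjI ballI)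
    fix y u assume y: "y \<in> ?X" and u: "u \<in> U"
    then have "anticommutator u v y \<in> S" "v (u y) \<in> S" using anti stable by auto
    then have "anticommutator u v y - v (u y) \<in> S" using ST(1) subspace_diff by blast
    then show "u (v y) \<in> S" by (simp add: anticommutator_def)
  qed (use stable in auto)
  then obtain y where "y \<in> ?X" "y \<notin> S" "v y \<in> S"
    by (rule nilpotent_escape[OF v x subspace_0[OF ST(1)]])
  then show "\<exists>x\<in>T - S. \<forall>u\<in>insert v U. u x \<in> S" by auto
qed

lemma strictly_triangularizable_singleton:
  "nilpotent_endo v \<Longrightarrow> strictly_triangularizable {v}"
  using strictly_triangularizable_insert[OF strictly_triangularizable_empty] by simp

lemma strictly_triangularizable_span:
  assumes "strictly_triangularizable U"
  shows "strictly_triangularizable (E.span U)"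
  unfolding strictly_triangularizable_def
proof (intro allI impI, elim conjE)
  fix S T assume ST: "subspace S" "subspace T" "S \<subset> T"
    and stable: "\<forall>u\<in>E.span U. u ` S \<subseteq> S \<and> u ` T \<subseteq> T"
  obtain x where x: "x \<in> T" "x \<notin> S" "\<And>u. u \<in> U \<Longrightarrow> u x \<in> S"
    using strictly_triangularizableD[OF assms ST] stable E.span_base by auto
  have "u x \<in> S" if "u \<in> E.span U" for u
    using that
  proof (induction rule: E.span_induct_alt)
    case base
    then show ?case using subspace_0[OF ST(1)] by simp
  next
    case (step c w u)
    then show ?case using x ST(1) by (auto simp: fun_scale_def subspace_add subspace_scale)
  qed
  then show "\<exists>x\<in>T - S. \<forall>u\<in>E.span U. u x \<in> S" using x by blast
qed

primrec kernel_chain :: "('v \<Rightarrow> 'v) set \<Rightarrow> nat \<Rightarrow> 'v set" where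
  "kernel_chain U 0 = {0}"
| "kernel_chain U (Suc i) = {x. \<forall>u\<in>U. u x \<in> kernel_chain U i}"

text \<open>The subtraction is truncated: for \<open>k \<ge> i + dim UNIV\<close> the condition says that \<open>w\<close> vanishes on
  \<open>kernel_chain U i\<close>.\<close>

definition lowers_kernel_chain :: "('v \<Rightarrow> 'v) set \<Rightarrow> nat \<Rightarrow> ('v \<Rightarrow> 'v) \<Rightarrow> bool" where
  "lowers_kernel_chain U k w \<longleftrightarrow> (\<forall>i. w ` kernel_chain U i \<subseteq> kernel_chain U (i + dim UNIV - k))"

context
  fixes U :: "('v \<Rightarrow> 'v) set"
  assumes linU: "\<And>u. u \<in> U \<Longrightarrow> lin u"
begin

lemma subspace_kernel_chain: "subspace (kernel_chain U i)"
proof (induction i)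
  case (Suc i)
  then have "subspace {x. u x \<in> kernel_chain U i}" if "u \<in> U" for u
    by (rule endo.linear_subspace_linear_preimage[OF linU[OF that]])
  moreover have "kernel_chain U (Suc i) = (\<Inter>u\<in>U. {x. u x \<in> kernel_chain U i})" by auto
  ultimately show ?case by (auto intro: subspace_Int)
qed simp

lemma kernel_chain_mono: "i \<le> j \<Longrightarrow> kernel_chain U i \<subseteq> kernel_chain U j"
proof (rule lift_Suc_mono_le[of "kernel_chain U"])
  show "kernel_chain U i \<subseteq> kernel_chain U (Suc i)" for i
    by (induction i) (auto simp: endo.linear_0[OF linU])
qed

lemma kernel_chain_pred:
  assumes "u \<in> U" and "x \<in> kernel_chain U i"
  shows "u x \<in> kernel_chain U (i - 1)"
  using assms by (cases i) (auto simp: endo.linear_0[OF linU])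

lemma kernel_chain_eq_UNIV:
  assumes triang: "strictly_triangularizable U" and "dim UNIV \<le> i"
  shows "kernel_chain U i = UNIV"
proof -
  have "kernel_chain U i = UNIV \<or> i \<le> dim (kernel_chain U i)"
  proof (induction i)
    case (Suc i)
    let ?S = "kernel_chain U i" and ?T = "kernel_chain U (Suc i)"
    have S_T: "?S \<subseteq> ?T" by (rule kernel_chain_mono) simp
    show ?case
    proof (cases "?S = UNIV")
      case True
      then show ?thesis using S_T by auto
    next
      case False
      then obtain x where "x \<notin> ?S" "\<And>u. u \<in> U \<Longrightarrow> u x \<in> ?S"
        using strictly_triangularizableD[OF triang subspace_kernel_chain subspace_UNIV, of i]
          S_T by (auto simp: subset_iff)
      then have "?S \<subset> ?T" using S_T by auto
      then have "dim ?S < dim ?T"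
        using subspace_dim_equal[OF subspace_kernel_chain subspace_kernel_chain S_T] by force
      then show ?thesis using Suc False by simp
    qed
  qed simp
  then show ?thesis
    using assms(2) subspace_dim_equal[OF subspace_kernel_chain subspace_UNIV subset_UNIV, of i]
    by auto
qed

lemma lowers_kernel_chain_0:
  "strictly_triangularizable U \<Longrightarrow> lowers_kernel_chain U 0 w"
  by (simp add: lowers_kernel_chain_def kernel_chain_eq_UNIV del: dim_UNIV)

lemma lowers_kernel_chain_anticommutator:
  assumes u: "u \<in> U" and w: "lin w" "lowers_kernel_chain U k w"
  shows "lowers_kernel_chain U (Suc k) (anticommutator u w)"
  unfolding lowers_kernel_chain_def
proof (intro allI image_subsetI)
  fix i x assume x: "x \<in> kernel_chain U i"
  let ?j = "i + dim UNIV - Suc k"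
  have w_lowers: "w y \<in> kernel_chain U (l + dim UNIV - k)" if "y \<in> kernel_chain U l" for l y
    using w(2) that by (auto simp: lowers_kernel_chain_def)
  show "anticommutator u w x \<in> kernel_chain U ?j"
  proof (cases i)
    case 0
    then have "anticommutator u w x = 0"
      using x endo.linear_0[OF w(1)] endo.linear_0[OF linU[OF u]] by (simp add: anticommutator_def)
    then show ?thesis using subspace_0[OF subspace_kernel_chain] by simp
  next
    case (Suc l)
    have "u (w x) \<in> kernel_chain U ?j"
      using kernel_chain_pred[OF u w_lowers[OF x]] by simp
    moreover have "w (u x) \<in> kernel_chain U ?j"
      using w_lowers[of "u x" l] kernel_chain_pred[OF u x] Suc by simp
    ultimately show ?thesis
      by (simp add: anticommutator_def subspace_add[OF subspace_kernel_chain])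
  qed
qed

lemma lowers_kernel_chain_imp_zero:
  assumes "strictly_triangularizable U" and w: "lowers_kernel_chain U (2 * dim UNIV) w"
  shows "w = 0"
proof
  fix x
  have "x \<in> kernel_chain U (dim UNIV)" using kernel_chain_eq_UNIV[OF assms(1)] by simp
  then show "w x = 0 x" using w by (fastforce simp: lowers_kernel_chain_def)
qed

text \<open>Jacobson's argument: otherwise, iterated anticommutators with \<open>U\<close> would give elements of
  \<open>V - U\<close> that lower the kernel chain arbitrarily far.\<close>

lemma anticommuting_element_exists:
  assumes triang: "strictly_triangularizable U" and U: "0 \<in> U" "U \<subset> V"
    and linV: "\<And>w. w \<in> V \<Longrightarrow> lin w"
    and anti: "\<And>u w. u \<in> U \<Longrightarrow> w \<in> V \<Longrightarrow> anticommutator u w \<in> V"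
  shows "\<exists>w\<in>V - U. \<forall>u\<in>U. anticommutator u w \<in> U"
proof (rule ccontr)
  assume none: "\<not> ?thesis"
  have "\<exists>w\<in>V - U. lowers_kernel_chain U k w" for k
  proof (induction k)
    case 0
    then show ?case using U lowers_kernel_chain_0[OF triang] by blast
  next
    case (Suc k)
    then obtain w where w: "w \<in> V - U" "lowers_kernel_chain U k w" by blast
    then obtain u where "u \<in> U" "anticommutator u w \<notin> U" using none by blast
    then show ?case
      using anti linV lowers_kernel_chain_anticommutator w by (metis DiffD1 DiffI)
  qed
  then obtain w where "w \<in> V - U" "lowers_kernel_chain U (2 * dim UNIV) w" by blast
  then show False using lowers_kernel_chain_imp_zero[OF triang] U(1) by blast
qed

end

lemma anticommutator_mem_of_square_mem:
  assumes V: "E.subspace V" and lin: "\<And>u. u \<in> V \<Longrightarrow> lin u" and square: "\<And>u. u \<in> V \<Longrightarrow> u \<circ> u \<in> V"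
    and u: "u \<in> V" and v: "v \<in> V"
  shows "anticommutator u v \<in> V"
proof -
  have "anticommutator u v = ((u + v) \<circ> (u + v)) - (u \<circ> u) - (v \<circ> v)"
    using endo.linear_add[OF lin[OF u]] endo.linear_add[OF lin[OF v]]
    by (simp add: anticommutator_def fun_eq_iff)
  then show ?thesis using V square u v by (simp add: E.subspace_add E.subspace_diff)
qed

theorem strictly_triangularizable_of_square_mem:
  assumes V: "E.subspace V" and lin: "\<And>u. u \<in> V \<Longrightarrow> lin u"
    and nil: "\<And>u. u \<in> V \<Longrightarrow> nilpotent_endo u" and square: "\<And>u. u \<in> V \<Longrightarrow> u \<circ> u \<in> V"
  shows "strictly_triangularizable V"
proof -
  let ?\<U> = "{U. E.subspace U \<and> U \<subseteq> V \<and> strictly_triangularizable U}"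
  have "finite_dim (fun_scale scale) V" by (rule finite_dim_lin_subset) (rule lin)
  moreover have "E.span {} \<in> ?\<U>"
    using strictly_triangularizable_span[OF strictly_triangularizable_empty] E.subspace_0[OF V]
    by auto
  ultimately have "\<exists>U\<in>?\<U>. \<forall>W\<in>?\<U>. U \<subseteq> W \<longrightarrow> W = U"
    by (rule E.maximal_subspace_exists[OF V]) auto
  then obtain U where U: "E.subspace U" "U \<subseteq> V" "strictly_triangularizable U"
    and maximal: "\<And>W. W \<in> ?\<U> \<Longrightarrow> U \<subseteq> W \<Longrightarrow> W = U"
    by auto
  have "U = V"
  proof (rule ccontr)
    assume "U \<noteq> V"
    then have "\<exists>w\<in>V - U. \<forall>u\<in>U. anticommutator u w \<in> U"
      using U lin E.subspace_0[OF U(1)]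
      by (intro anticommuting_element_exists anticommutator_mem_of_square_mem[OF V lin square]) auto
    then obtain w where w: "w \<in> V" "w \<notin> U" "\<And>u. u \<in> U \<Longrightarrow> anticommutator u w \<in> U" by blast
    let ?W = "E.span (insert w U)"
    have "strictly_triangularizable ?W"
      using strictly_triangularizable_insert[OF U(3) nil[OF w(1)] w(3)]
      by (rule strictly_triangularizable_span)
    moreover have "?W \<subseteq> V" using V U(2) w(1) by (intro E.span_minimal) auto
    ultimately have "?W = U"
      using maximal[of ?W] E.span_superset[of "insert w U"] by auto
    then show False using w(2) E.span_base by blast
  qed
  then show ?thesis using U(3) by simp
qed

definition descending_flag :: "('v \<Rightarrow> 'v) set \<Rightarrow> nat \<Rightarrow> nat \<Rightarrow> (nat \<Rightarrow> 'v set) \<Rightarrow> bool" where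
  "descending_flag U m n F \<longleftrightarrow>
     (\<forall>i\<in>{m..n}. subspace (F i) \<and> dim (F i) = i) \<and>
     (\<forall>i\<in>{m..<n}. F i \<subseteq> F (Suc i) \<and> (\<forall>u\<in>U. u ` F (Suc i) \<subseteq> F i))"

lemma descending_flagD:
  assumes "descending_flag U m n F"
  shows "i \<in> {m..n} \<Longrightarrow> subspace (F i) \<and> dim (F i) = i"
    and "i \<in> {m..<n} \<Longrightarrow> F i \<subseteq> F (Suc i) \<and> (\<forall>u\<in>U. u ` F (Suc i) \<subseteq> F i)"
  using assms unfolding descending_flag_def by blast+

lemma descending_flag_exists:
  assumes triang: "strictly_triangularizable U" and lin: "\<And>u. u \<in> U \<Longrightarrow> lin u"
    and T: "subspace T" "\<And>u. u \<in> U \<Longrightarrow> u ` T \<subseteq> T"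
    and S: "subspace S" "S \<subseteq> T" "\<And>u. u \<in> U \<Longrightarrow> u ` S \<subseteq> S"
  shows "\<exists>F. descending_flag U (dim S) (dim T) F \<and> F (dim S) = S \<and> F (dim T) = T"
  using S
proof (induction "dim T - dim S" arbitrary: S)
  case 0
  then have "S = T" using T(1) by (intro subspace_dim_equal) auto
  then show ?case using 0 by (intro exI[of _ "\<lambda>_. T"]) (auto simp: descending_flag_def)
next
  case (Suc d)
  then have "S \<subset> T" by auto
  then obtain x where x: "x \<in> T" "x \<notin> S" "\<And>u. u \<in> U \<Longrightarrow> u x \<in> S"
    using strictly_triangularizableD[OF triang Suc.prems(1) T(1)] Suc.prems(3) T(2) by blast
  let ?S' = "span (insert x S)"
  have S_S': "S \<subseteq> ?S'" using span_superset by blast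
  have lowers: "u ` ?S' \<subseteq> S" if "u \<in> U" for u
    using lin Suc.prems(1,3) x(3) that by (intro image_span_insert_subset)
  have "x \<notin> span S" using x(2) Suc.prems(1) span_minimal[of S S] by auto
  then have dim_S': "dim ?S' = Suc (dim S)" using dim_insert[of x S] by simp
  have S'_T: "?S' \<subseteq> T" using x(1) Suc.prems(2) T(1) by (intro span_minimal) auto
  have "\<exists>F. descending_flag U (dim ?S') (dim T) F \<and> F (dim ?S') = ?S' \<and> F (dim T) = T"
  proof (rule Suc.hyps(1))
    show "d = dim T - dim ?S'" unfolding dim_S' using Suc.hyps(2) by simp
    show "u ` ?S' \<subseteq> ?S'" if "u \<in> U" for u using lowers[OF that] S_S' by blast
  qed (use S'_T in auto)
  then obtain F where F: "descending_flag U (Suc (dim S)) (dim T) F"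
      "F (Suc (dim S)) = ?S'" "F (dim T) = T"
    unfolding dim_S' by blast
  let ?F = "F(dim S := S)"
  have "subspace (?F i) \<and> dim (?F i) = i" if "i \<in> {dim S..dim T}" for i
    using F(1) Suc.prems(1) that by (cases "i = dim S") (simp_all add: descending_flag_def)
  moreover have "?F i \<subseteq> ?F (Suc i) \<and> (\<forall>u\<in>U. u ` ?F (Suc i) \<subseteq> ?F i)" if "i \<in> {dim S..<dim T}" for i
    using F(1,2) S_S' lowers that by (cases "i = dim S") (simp_all add: descending_flag_def)
  ultimately have "descending_flag U (dim S) (dim T) ?F" by (simp add: descending_flag_def)
  moreover have "dim S \<noteq> dim T" using Suc.hyps(2) by simp
  ultimately show ?case using F(3) by (intro exI[of _ ?F]) simp
qed

lemma descending_flag_append: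
  assumes "descending_flag U l m F" and "descending_flag U m n G" and "F m = G m"
  shows "descending_flag U l n (\<lambda>i. if i \<le> m then F i else G i)"
proof -
  let ?H = "\<lambda>i. if i \<le> m then F i else G i"
  have "subspace (?H i) \<and> dim (?H i) = i" if "i \<in> {l..n}" for i
    using descending_flagD(1)[OF assms(1), of i] descending_flagD(1)[OF assms(2), of i] that by simp
  moreover have "?H i \<subseteq> ?H (Suc i) \<and> (\<forall>u\<in>U. u ` ?H (Suc i) \<subseteq> ?H i)" if "i \<in> {l..<n}" for i
  proof (cases "i < m")
    case True
    then show ?thesis using descending_flagD(2)[OF assms(1), of i] that by simp
  next
    case False
    moreover have "?H i = G i" using False assms(3) by simp
    ultimately show ?thesis using descending_flagD(2)[OF assms(2), of i] that by simp
  qed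
  ultimately show ?thesis by (simp add: descending_flag_def)
qed

section \<open>Traces of endomorphisms\<close>

definition tr :: "('v \<Rightarrow> 'v) \<Rightarrow> 'k" where
  "tr u = (\<Sum>e\<in>Basis. representation Basis (u e) e)"

lemma tr_add: "tr (u + v) = tr u + tr v"
  by (simp add: tr_def coord.add sum.distrib)

lemma tr_diff: "tr (u - v) = tr u - tr v"
  by (simp add: tr_def coord.diff sum_subtractf)

lemma tr_scale: "tr (fun_scale scale c u) = c * tr u"
  by (simp add: tr_def fun_scale_def coord.scale sum_distrib_left)

lemma tr_rank_one:
  assumes "Vector_Spaces.linear scale (*) \<phi>"
  shows "tr (\<lambda>w. \<phi> w *s x) = \<phi> x"
proof -
  interpret \<phi>: Vector_Spaces.linear scale "(*)" \<phi> by fact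
  have "\<phi> x = (\<Sum>e\<in>Basis. representation Basis x e * \<phi> e)"
    using \<phi>.sum[of "\<lambda>e. representation Basis x e *s e" Basis] by (simp add: sum_coord \<phi>.scale)
  then show ?thesis by (simp add: tr_def coord.scale mult.commute)
qed

definition basis_list :: "'v list" where
  "basis_list = (SOME es. set es = Basis \<and> distinct es)"

lemma set_basis_list: "set basis_list = Basis" and distinct_basis_list: "distinct basis_list"
  unfolding basis_list_def
  using someI_ex[OF finite_distinct_list[OF finite_Basis]] by auto

lemma sum_basis_list: "(\<Sum>i<length basis_list. f (basis_list ! i)) = (\<Sum>e\<in>Basis. f e)"
  using sum.reindex_bij_betw[OF bij_betw_nth[OF distinct_basis_list refl refl], of f]
  by (simp add: set_basis_list)

definition matrix_of :: "('v \<Rightarrow> 'v) \<Rightarrow> 'k mat" where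
  "matrix_of u = mat (length basis_list) (length basis_list)
     (\<lambda>(i, j). representation Basis (u (basis_list ! j)) (basis_list ! i))"

lemma matrix_of_carrier [simp]: "matrix_of u \<in> carrier_mat (length basis_list) (length basis_list)"
  by (simp add: matrix_of_def)

lemma matrix_of_comp:
  assumes u: "lin u"
  shows "matrix_of (u \<circ> v) = matrix_of u * matrix_of v"
proof (rule eq_matI)
  fix i j assume "i < dim_row (matrix_of u * matrix_of v)" "j < dim_col (matrix_of u * matrix_of v)"
  then have ij: "i < length basis_list" "j < length basis_list" by (auto simp: matrix_of_def)
  let ?y = "v (basis_list ! j)" and ?d = "basis_list ! i"
  have "representation Basis (u ?y) ?d =
      (\<Sum>e\<in>Basis. representation Basis ?y e * representation Basis (u e) ?d)"
    by (subst lin_expand[OF u]) (simp add: coord.sum coord.scale)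
  then show "matrix_of (u \<circ> v) $$ (i, j) = (matrix_of u * matrix_of v) $$ (i, j)"
    using ij by (simp add: matrix_of_def scalar_prod_def mult.commute
        flip: sum_basis_list lessThan_atLeast0)
qed (auto simp: matrix_of_def)

lemma matrix_of_id: "matrix_of id = 1\<^sub>m (length basis_list)"
proof (rule eq_matI)
  fix i j
  assume "i < dim_row (1\<^sub>m (length basis_list) :: 'k mat)"
    and "j < dim_col (1\<^sub>m (length basis_list) :: 'k mat)"
  then have ij: "i < length basis_list" "j < length basis_list" by simp_all
  then have "basis_list ! j \<in> Basis" using set_basis_list nth_mem by blast
  then show "matrix_of id $$ (i, j) = 1\<^sub>m (length basis_list) $$ (i, j)"
    using ij distinct_basis_list
    by (auto simp: matrix_of_def representation_basis[OF independent_Basis] nth_eq_iff_index_eq)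
qed (auto simp: matrix_of_def)

lemma matrix_of_funpow:
  assumes u: "lin u"
  shows "matrix_of (u ^^ k) = matrix_of u ^\<^sub>m k"
proof (induction k)
  case 0
  then show ?case using matrix_of_id by (simp add: id_def matrix_of_def)
next
  case (Suc k)
  have "matrix_of (u ^^ Suc k) = matrix_of (u ^^ k) * matrix_of u"
    unfolding funpow_Suc_right by (rule matrix_of_comp[OF lin_funpow[OF u]])
  then show ?case by (simp only: Suc pow_mat.simps)
qed

lemma matrix_of_add: "matrix_of (u + v) = matrix_of u + matrix_of v"
  and matrix_of_diff: "matrix_of (u - v) = matrix_of u - matrix_of v"
  by (auto simp: matrix_of_def coord.add coord.diff)

lemma nilpotent_mat_matrix_of:
  assumes "lin u" and "nilpotent_endo u"
  shows "nilpotent_mat (matrix_of u)"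
proof -
  obtain k where "u ^^ k = (\<lambda>_. 0)" using assms(2) by (auto simp: nilpotent_endo_def)
  then have "matrix_of u ^\<^sub>m k = matrix_of (\<lambda>_. 0)"
    using matrix_of_funpow[OF assms(1), of k] by simp
  also have "\<dots> = 0\<^sub>m (length basis_list) (length basis_list)"
    by (auto simp: matrix_of_def coord.zero)
  finally show ?thesis unfolding nilpotent_mat_def using matrix_of_carrier carrier_matD(1) by metis
qed

lemma mat_trace_matrix_of: "mat_trace (matrix_of u) = tr u"
  using sum_basis_list[of "\<lambda>e. representation Basis (u e) e"]
  by (simp add: mat_trace_def matrix_of_def tr_def)

lemma tr_comp_nilpotent:
  assumes char: "(2::'k) \<noteq> 0" and lin: "lin u" "lin v"
    and nil: "nilpotent_endo u" "nilpotent_endo v" "nilpotent_endo (u + v)" "nilpotent_endo (u - v)"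
  shows "tr (u \<circ> v) = 0" and "tr (u \<circ> u \<circ> v) = 0"
proof -
  have "lin (u + v)" "lin (u - v)"
    using subspace_lin E.subspace_add[of "{u. lin u}" u v] E.subspace_diff[of "{u. lin u}" u v] lin
    by auto
  then have "nilpotent_mat (matrix_of u + matrix_of v)" "nilpotent_mat (matrix_of u - matrix_of v)"
    using nil(3,4) nilpotent_mat_matrix_of by (metis matrix_of_add, metis matrix_of_diff)
  note traces = mat_trace_mult_nilpotent[OF matrix_of_carrier matrix_of_carrier char
      nilpotent_mat_matrix_of[OF lin(1) nil(1)] nilpotent_mat_matrix_of[OF lin(2) nil(2)] this]
  show "tr (u \<circ> v) = 0"
    using traces(1) by (simp add: matrix_of_comp lin flip: mat_trace_matrix_of)
  show "tr (u \<circ> u \<circ> v) = 0"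
    using traces(2) Vector_Spaces.linear_compose[OF lin(1) lin(1)]
    by (simp add: matrix_of_comp lin flip: mat_trace_matrix_of)
qed

end

section \<open>Singular flags of an alternating form\<close>

locale alternating_space = endomorphism_space scale Basis
  for scale :: "'k::field \<Rightarrow> 'v::ab_group_add \<Rightarrow> 'v" (infixr \<open>*s\<close> 75) and Basis :: "'v set" +
  fixes b :: "'v \<Rightarrow> 'v \<Rightarrow> 'k"
  assumes bilinear: "bilinear_form scale b" and alternating: "alternating_form b"
begin

sublocale left: Vector_Spaces.linear scale "(*)" "\<lambda>x. b x y" for y
  using bilinear by (simp add: bilinear_form_def)

sublocale right: Vector_Spaces.linear scale "(*)" "b x" for x
  using bilinear by (simp add: bilinear_form_def)

lemma b_self [simp]: "b x x = 0"
  using alternating by (simp add: alternating_form_def)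

lemma b_skew: "b x y = - b y x"
proof -
  have "b (x + y) (x + y) = b x y + b y x"
    unfolding left.add right.add by simp
  then show ?thesis by (simp add: eq_neg_iff_add_eq_0)
qed

lemma b_eq_0_sym: "b x y = 0 \<longleftrightarrow> b y x = 0"
  using b_skew[of x y] by simp

lemma bilinear_on_b: "bilinear_on scale scale V W b"
  by (simp add: bilinear_on_def functional_on_def left.add left.scale right.add right.scale)

definition perp :: "'v set \<Rightarrow> 'v set" where
  "perp X = {y. \<forall>x\<in>X. b x y = 0}"

lemma subspace_perp [simp]: "subspace (perp X)"
  unfolding subspace_def perp_def by (simp add: right.add right.scale)

lemma perp_UNIV: "perp UNIV = Rad b"
  by (simp add: perp_def Rad_def)

lemma subspace_Rad [simp]: "subspace (Rad b)"
  using subspace_perp[of UNIV] by (simp add: perp_UNIV)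

lemma perp_antimono: "X \<subseteq> Y \<Longrightarrow> perp Y \<subseteq> perp X"
  by (auto simp: perp_def)

lemma Rad_subset_perp: "Rad b \<subseteq> perp X"
  using perp_antimono[of X UNIV] by (simp add: perp_UNIV)

lemma subset_perp_iff: "X \<subseteq> perp Y \<longleftrightarrow> Y \<subseteq> perp X"
  unfolding perp_def using b_eq_0_sym by blast

lemma perp_Rad: "perp (Rad b) = UNIV"
  using subset_perp_iff[of UNIV "Rad b"] by (auto simp: perp_UNIV)

lemma totally_singular_iff: "totally_singular b X \<longleftrightarrow> X \<subseteq> perp X"
  by (auto simp: totally_singular_def perp_def)

lemma totally_singular_span:
  assumes "totally_singular b X"
  shows "totally_singular b (span X)"
proof -
  have "span X \<subseteq> perp X" using assms by (intro span_minimal) (auto simp: totally_singular_iff)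
  then have "X \<subseteq> perp (span X)" using subset_perp_iff by blast
  then show ?thesis by (simp add: totally_singular_iff span_minimal)
qed

lemma totally_singular_insert:
  "totally_singular b X \<Longrightarrow> x \<in> perp X \<Longrightarrow> totally_singular b (insert x X)"
  using b_eq_0_sym by (auto simp: totally_singular_def perp_def)

lemma dim_perp:
  assumes G: "subspace G"
  shows "dim (perp G) + dim G = dim UNIV + dim (G \<inter> Rad b)"
proof -
  have vs: "vector_space scale" by unfold_locales
  have kernels: "{y \<in> G. \<forall>x\<in>UNIV. b x y = 0} = G \<inter> Rad b" "{x \<in> G. \<forall>y\<in>UNIV. b x y = 0} = G \<inter> Rad b"
    "{x \<in> UNIV. \<forall>y\<in>G. b x y = 0} = perp G" "{y \<in> UNIV. \<forall>x\<in>G. b x y = 0} = perp G"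
    using b_eq_0_sym by (auto simp: Rad_def perp_def)
  have "dim UNIV + dim (G \<inter> Rad b) \<le> dim G + dim (perp G)"
    using bilinear_on_dim_le[OF vs vs subspace_UNIV finite_dim_all G finite_dim_all bilinear_on_b]
    unfolding kernels .
  moreover have "dim G + dim (perp G) \<le> dim UNIV + dim (G \<inter> Rad b)"
    using bilinear_on_dim_le[OF vs vs G finite_dim_all subspace_UNIV finite_dim_all bilinear_on_b]
    unfolding kernels .
  ultimately show ?thesis by simp
qed

lemma dim_perp_supset_Rad:
  assumes "subspace G" and "Rad b \<subseteq> G"
  shows "dim (perp G) + dim G = dim UNIV + dim (Rad b)"
  using dim_perp[OF assms(1)] assms(2) by (simp add: Int_absorb1)

lemma perp_perp:
  assumes "subspace G" and "Rad b \<subseteq> G"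
  shows "perp (perp G) = G"
proof -
  have "dim (perp (perp G)) = dim G"
    using dim_perp_supset_Rad[OF subspace_perp Rad_subset_perp, of G] dim_perp_supset_Rad[OF assms]
    by simp
  moreover have "G \<subseteq> perp (perp G)" using subset_perp_iff by blast
  ultimately show ?thesis using subspace_dim_equal[OF assms(1) subspace_perp, of "perp G"] by simp
qed

lemma dim_totally_singular_le:
  assumes X: "subspace X" "totally_singular b X"
  shows "2 * dim X \<le> dim UNIV + dim (Rad b)"
proof -
  have "dim X \<le> dim (perp X)" using X(2) by (intro dim_subset) (simp add: totally_singular_iff)
  moreover have "dim (X \<inter> Rad b) \<le> dim (Rad b)" by (rule dim_subset) auto
  ultimately show ?thesis using dim_perp[OF X(1)] by simp
qed

abbreviation balt :: "('v \<Rightarrow> 'v) \<Rightarrow> bool" where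
  "balt \<equiv> b_alternating scale b"

lemma balt_lin: "balt u \<Longrightarrow> lin u"
  by (simp add: b_alternating_def)

lemma balt_adjoint:
  assumes u: "balt u"
  shows "b x (u y) = b (u x) y"
proof -
  have "b (x + y) (u (x + y)) = 0" "b x (u x) = 0" "b y (u y) = 0"
    using u by (auto simp: b_alternating_def)
  then have "b x (u y) + b y (u x) = 0"
    by (simp add: endo.linear_add[OF balt_lin[OF u]] left.add right.add add.commute)
  then show ?thesis using b_skew[of y "u x"] by (simp add: eq_neg_iff_add_eq_0)
qed

lemma subspace_balt: "E.subspace {u. balt u}"
  using subspace_lin unfolding E.subspace_def b_alternating_def
  by (auto simp: fun_scale_def right.add right.scale)

lemma balt_image_perp_subset: "balt u \<Longrightarrow> u ` X \<subseteq> Y \<Longrightarrow> u ` perp Y \<subseteq> perp X"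
  by (force simp: perp_def balt_adjoint)

lemma balt_image_Rad_subset: "balt u \<Longrightarrow> u ` Rad b \<subseteq> Rad b"
  using balt_image_perp_subset[of u UNIV UNIV] by (simp add: perp_UNIV)

lemma lagrangian_exists:
  assumes triang: "strictly_triangularizable U" and balt: "\<And>u. u \<in> U \<Longrightarrow> balt u"
  shows "\<exists>L. subspace L \<and> Rad b \<subseteq> L \<and> perp L = L \<and> (\<forall>u\<in>U. u ` L \<subseteq> L)"
proof -
  let ?\<L> = "{L. subspace L \<and> Rad b \<subseteq> L \<and> totally_singular b L \<and> (\<forall>u\<in>U. u ` L \<subseteq> L)}"
  have "Rad b \<in> ?\<L>"
    using balt_image_Rad_subset[OF balt] by (auto simp: totally_singular_iff Rad_subset_perp)
  then have "\<exists>L\<in>?\<L>. \<forall>M\<in>?\<L>. L \<subseteq> M \<longrightarrow> M = L"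
    by (rule maximal_subspace_exists[OF subspace_UNIV finite_dim_all]) auto
  then obtain L where L: "subspace L" "Rad b \<subseteq> L" "totally_singular b L" "\<And>u. u \<in> U \<Longrightarrow> u ` L \<subseteq> L"
    and maximal: "\<And>M. M \<in> ?\<L> \<Longrightarrow> L \<subseteq> M \<Longrightarrow> M = L"
    by auto
  have "perp L = L"
  proof (rule ccontr)
    assume "perp L \<noteq> L"
    then have "L \<subset> perp L" using L(3) by (auto simp: totally_singular_iff)
    then have "\<exists>x\<in>perp L - L. \<forall>u\<in>U. u x \<in> L"
      using L balt_image_perp_subset[OF balt] by (intro strictly_triangularizableD[OF triang]) auto
    then obtain x where x: "x \<in> perp L" "x \<notin> L" "\<And>u. u \<in> U \<Longrightarrow> u x \<in> L" by blast
    let ?M = "span (insert x L)"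
    have L_M: "insert x L \<subseteq> ?M" by (rule span_superset)
    then have "Rad b \<subseteq> ?M" using L(2) by blast
    moreover have "totally_singular b ?M"
      using L(3) x(1) by (intro totally_singular_span totally_singular_insert)
    moreover have "u ` ?M \<subseteq> ?M" if u: "u \<in> U" for u
      using image_span_insert_subset[OF balt_lin[OF balt[OF u]] L(1) L(4)[OF u] x(3)[OF u]] L_M
      by blast
    ultimately have "?M \<in> ?\<L>" by simp
    then have "?M = L" using maximal[of ?M] L_M by blast
    then show False using x(2) L_M by blast
  qed
  then show ?thesis using L by blast
qed

lemma dim_lagrangian:
  assumes "subspace L" and "Rad b \<subseteq> L" and "perp L = L"
  shows "2 * dim L = dim UNIV + dim (Rad b)"
  using dim_perp_supset_Rad[OF assms(1,2)] assms(3) by simp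

abbreviation witt :: nat where
  "witt \<equiv> witt_index scale b"

lemma two_mult_witt_index: "2 * witt = dim UNIV + dim (Rad b)"
proof -
  obtain L where L: "subspace L" "Rad b \<subseteq> L" "perp L = L"
    using lagrangian_exists[OF strictly_triangularizable_empty] by auto
  have "witt = dim L"
    unfolding witt_index_def
  proof (rule Max_eqI)
    have "{dim X |X. subspace X \<and> totally_singular b X} \<subseteq> {..dim UNIV}"
      using dim_subset[OF subset_UNIV] by auto
    then show "finite {dim X |X. subspace X \<and> totally_singular b X}"
      by (rule finite_subset) simp
    show "dim L \<in> {dim X |X. subspace X \<and> totally_singular b X}"
      using L by (auto simp: totally_singular_iff)
  next
    fix d assume "d \<in> {dim X |X. subspace X \<and> totally_singular b X}"
    then obtain X where X: "subspace X" "totally_singular b X" "d = dim X" by blast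
    then show "d \<le> dim L" using dim_totally_singular_le[OF X(1,2)] dim_lagrangian[OF L] by simp
  qed
  then show ?thesis using dim_lagrangian[OF L] by simp
qed

lemma dim_Rad_le_dim: "dim (Rad b) \<le> dim UNIV"
  by (rule dim_subset) simp

lemma dim_Rad_le_witt: "dim (Rad b) \<le> witt"
  and witt_le_dim: "witt \<le> dim UNIV"
  using two_mult_witt_index dim_Rad_le_dim by linarith+

definition maximal_singular_flag :: "(nat \<Rightarrow> 'v set) \<Rightarrow> bool" where
  "maximal_singular_flag F \<longleftrightarrow> partially_complete_flag scale witt F \<and>
     totally_singular b (F witt) \<and> F (dim (Rad b)) = Rad b"

definition nil_stab :: "(nat \<Rightarrow> 'v set) \<Rightarrow> ('v \<Rightarrow> 'v) set" where
  "nil_stab F = {u. balt u \<and> (\<forall>i<witt. u ` F (Suc i) \<subseteq> F i)}"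

lemma nil_stab_balt: "u \<in> nil_stab F \<Longrightarrow> balt u"
  by (simp add: nil_stab_def)

lemma nil_stab_lin: "u \<in> nil_stab F \<Longrightarrow> lin u"
  by (rule balt_lin[OF nil_stab_balt])

lemma finite_dim_nil_stab: "finite_dim (fun_scale scale) (nil_stab F)"
  by (rule finite_dim_lin_subset) (rule nil_stab_lin)

lemma maximal_singular_flag_exists:
  assumes triang: "strictly_triangularizable U" and balt: "\<And>u. u \<in> U \<Longrightarrow> balt u"
  shows "\<exists>F. maximal_singular_flag F \<and> U \<subseteq> nil_stab F"
proof -
  obtain L where L: "subspace L" "Rad b \<subseteq> L" "perp L = L" "\<And>u. u \<in> U \<Longrightarrow> u ` L \<subseteq> L"
    using lagrangian_exists[OF assms] by blast
  have dim_L: "dim L = witt"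
    using dim_lagrangian[OF L(1-3)] two_mult_witt_index by simp
  note flag_exists = descending_flag_exists[OF triang balt_lin[OF balt]]
  have "\<exists>F. descending_flag U (dim {0}) (dim (Rad b)) F \<and>
      F (dim {0}) = {0} \<and> F (dim (Rad b)) = Rad b"
    using balt_image_Rad_subset[OF balt] endo.linear_0[OF balt_lin[OF balt]]
      subspace_0[OF subspace_Rad]
    by (intro flag_exists) auto
  then obtain F where F: "descending_flag U 0 (dim (Rad b)) F" "F (dim (Rad b)) = Rad b" by auto
  have "\<exists>G. descending_flag U (dim (Rad b)) (dim L) G \<and> G (dim (Rad b)) = Rad b \<and> G (dim L) = L"
    using balt_image_Rad_subset[OF balt] L by (intro flag_exists) auto
  then obtain G where G: "descending_flag U (dim (Rad b)) (dim L) G"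
      "G (dim (Rad b)) = Rad b" "G (dim L) = L"
    by blast
  define H where "H = (\<lambda>i. if i \<le> dim (Rad b) then F i else G i)"
  have H: "descending_flag U 0 (dim L) H" "H (dim (Rad b)) = Rad b" "H (dim L) = L"
    using F G dim_Rad_le_witt dim_L by (auto simp: H_def intro: descending_flag_append)
  then have "maximal_singular_flag H"
    using L(3) unfolding maximal_singular_flag_def dim_L[symmetric]
    by (simp add: descending_flag_def partially_complete_flag_def totally_singular_iff)
  moreover have "U \<subseteq> nil_stab H"
  proof
    fix u assume u: "u \<in> U"
    then have "u ` H (Suc i) \<subseteq> H i" if "i < dim L" for i
      using descending_flagD(2)[OF H(1), of i] that by simp
    then show "u \<in> nil_stab H" using balt[OF u] by (simp add: nil_stab_def dim_L)
  qed
  ultimately show ?thesis by blast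
qed

lemma subspace_nil_stab:
  assumes F: "partially_complete_flag scale witt F"
  shows "E.subspace (nil_stab F)"
proof -
  have sub: "subspace (F i)" if "i < witt" for i
    using F that by (simp add: partially_complete_flag_def)
  show ?thesis
    using E.subspace_0[OF subspace_balt] E.subspace_add[OF subspace_balt]
      E.subspace_scale[OF subspace_balt]
    by (auto intro!: E.subspaceI simp: nil_stab_def image_subset_iff fun_scale_def
        subspace_0[OF sub] subspace_add[OF sub] subspace_scale[OF sub])
qed

lemma nil_stab_of_nilpotent:
  assumes F: "partially_complete_flag scale witt F" and u: "balt u" "nilpotent_endo u"
    and stable: "stabilizes_flag witt F u"
  shows "u \<in> nil_stab F"
proof -
  have "u ` F (Suc i) \<subseteq> F i" if i: "i < witt" for i
  proof -
    have F_i: "subspace (F i)" "subspace (F (Suc i))" "F i \<subseteq> F (Suc i)"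
      "dim (F (Suc i)) = Suc (dim (F i))"
      using F i by (auto simp: partially_complete_flag_def)
    have stable_i: "u ` F i \<subseteq> F i" "u ` F (Suc i) \<subseteq> F (Suc i)"
      using stable i by (auto simp: stabilizes_flag_def)
    have "\<not> F (Suc i) \<subseteq> F i" using F_i(4) dim_subset[of "F (Suc i)" "F i"] by auto
    then obtain x where "x \<in> F (Suc i)" "x \<notin> F i" by blast
    then obtain y where y: "y \<in> F (Suc i)" "y \<notin> F i" "u y \<in> F i"
      by (rule nilpotent_escape[OF u(2) _ _ subspace_0[OF F_i(1)] stable_i(2)])
    have "F (Suc i) = span (insert y (F i))" by (rule subspace_eq_span_insert) (use F_i y in auto)
    then show ?thesis
      using image_span_insert_subset[OF balt_lin[OF u(1)] F_i(1) stable_i(1) y(3)] by simp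
  qed
  then show ?thesis using u(1) by (simp add: nil_stab_def)
qed

lemma nil_stab_stabilizes_flag:
  assumes F: "partially_complete_flag scale witt F" and u: "u \<in> nil_stab F"
  shows "stabilizes_flag witt F u"
  unfolding stabilizes_flag_def
proof (intro allI impI)
  fix i assume i: "i \<le> witt"
  show "u ` F i \<subseteq> F i"
  proof (cases i)
    case 0
    then show ?thesis
      using partially_complete_flag_0[OF F] endo.linear_0[OF nil_stab_lin[OF u]] by simp
  next
    case (Suc j)
    then have "u ` F i \<subseteq> F j" using u i by (auto simp: nil_stab_def Suc_le_eq)
    then show ?thesis using partially_complete_flag_mono[OF F, of j i] Suc i by auto
  qed
qed

end

section \<open>The dimension of the stabilizer of a singular flag\<close>

lemma sum_min_lessThan:
  fixes m n :: nat
  assumes "m \<le> n"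
  shows "(\<Sum>j<n. min m j) = (m choose 2) + m * (n - m)"
  using assms
proof (induction n rule: dec_induct)
  case base
  have "(\<Sum>j<m. min m j) = (\<Sum>j<m. j)" by (intro sum.cong) auto
  also have "\<dots> = m choose 2" by (induction m) (auto simp: numeral_2_eq_2)
  finally show ?case by simp
next
  case (step n)
  then show ?case by (simp add: Suc_diff_le)
qed

lemma sum_reflected_interval_lessThan:
  fixes p m :: nat
  shows "(\<Sum>j<p + m. j - (2 * p - j)) \<le> m * (m - 1)"
proof (induction m)
  case (Suc m)
  then have "(\<Sum>j<p + Suc m. j - (2 * p - j)) \<le> m * (m - 1) + 2 * m" by simp
  also have "\<dots> = Suc m * (Suc m - 1)" by (cases m) auto
  finally show ?case .
qed simp

lemma (in endomorphism_space) functional_on_evaluation: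
  assumes "Vector_Spaces.linear scale (*) \<psi>"
  shows "functional_on (fun_scale scale) V (\<lambda>u. \<psi> (u x))"
proof -
  interpret \<psi>: Vector_Spaces.linear scale "(*)" \<psi> by fact
  show ?thesis by (simp add: functional_on_def fun_scale_def \<psi>.add \<psi>.scale)
qed

context alternating_space
begin

definition perp_completion :: "(nat \<Rightarrow> 'v set) \<Rightarrow> nat \<Rightarrow> 'v set" where
  "perp_completion F j = (if j \<le> witt then F j else perp (F (2 * witt - j)))"

context
  fixes F :: "nat \<Rightarrow> 'v set"
  assumes F: "maximal_singular_flag F"
begin

lemma flag_partially_complete: "partially_complete_flag scale witt F"
  using F by (simp add: maximal_singular_flag_def)

lemma flag_at_dim_Rad: "F (dim (Rad b)) = Rad b"
  using F by (simp add: maximal_singular_flag_def)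

lemma subspace_flag: "i \<le> witt \<Longrightarrow> subspace (F i)"
  and dim_flag: "i \<le> witt \<Longrightarrow> dim (F i) = i"
  using flag_partially_complete by (auto simp: partially_complete_flag_def)

lemma flag_mono: "i \<le> j \<Longrightarrow> j \<le> witt \<Longrightarrow> F i \<subseteq> F j"
  by (rule partially_complete_flag_mono[OF flag_partially_complete])

lemma flag_subset_Rad: "i \<le> dim (Rad b) \<Longrightarrow> F i \<subseteq> Rad b"
  using flag_mono[of i "dim (Rad b)"] flag_at_dim_Rad dim_Rad_le_witt by simp

lemma Rad_subset_flag: "dim (Rad b) \<le> i \<Longrightarrow> i \<le> witt \<Longrightarrow> Rad b \<subseteq> F i"
  using flag_mono[of "dim (Rad b)" i] flag_at_dim_Rad by simp

lemma flag_orthogonal: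
  "i \<le> witt \<Longrightarrow> j \<le> witt \<Longrightarrow> x \<in> F i \<Longrightarrow> y \<in> F j \<Longrightarrow> b x y = 0"
  using F flag_mono[of i witt] flag_mono[of j witt]
  unfolding maximal_singular_flag_def totally_singular_def by blast

lemma dim_perp_flag:
  assumes "dim (Rad b) \<le> i" and "i \<le> witt"
  shows "dim (perp (F i)) = 2 * witt - i"
  using dim_perp_supset_Rad[OF subspace_flag Rad_subset_flag, of i] assms dim_flag[of i]
    two_mult_witt_index by simp

lemma perp_flag_witt: "perp (F witt) = F witt"
proof -
  have "F witt \<subseteq> perp (F witt)"
    using flag_orthogonal[of witt witt] by (auto simp: perp_def)
  then show ?thesis
    using subspace_dim_equal[OF subspace_flag[of witt] subspace_perp, of "F witt"]
      dim_perp_flag[of witt] dim_flag[of witt] dim_Rad_le_witt by simp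
qed

lemma perp_completion_ge:
  "witt \<le> j \<Longrightarrow> perp_completion F j = perp (F (2 * witt - j))"
  using perp_flag_witt by (cases "j = witt") (auto simp: perp_completion_def)

lemma perp_completion_flag:
  "partially_complete_flag scale (dim UNIV) (perp_completion F)"
proof -
  have "subspace (perp_completion F j) \<and> dim (perp_completion F j) = j" if "j \<le> dim UNIV" for j
  proof (cases "j \<le> witt")
    case False
    then have "dim (Rad b) \<le> 2 * witt - j" using that two_mult_witt_index by linarith
    then show ?thesis
      using False that dim_perp_flag[of "2 * witt - j"] two_mult_witt_index
      by (simp add: perp_completion_def)
  qed (simp add: perp_completion_def subspace_flag dim_flag)
  moreover have "perp_completion F j \<subseteq> perp_completion F (Suc j)" for j
  proof (cases "j < witt")
    case True
    then show ?thesis using flag_mono[of j "Suc j"] by (simp add: perp_completion_def)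
  next
    case False
    then have "F (2 * witt - Suc j) \<subseteq> F (2 * witt - j)"
      by (intro flag_mono) auto
    then show ?thesis using False by (simp add: perp_completion_ge perp_antimono)
  qed
  ultimately show ?thesis by (simp add: partially_complete_flag_def del: dim_UNIV)
qed

lemma perp_completion_dim_UNIV: "perp_completion F (dim UNIV) = UNIV"
  using perp_completion_ge[OF witt_le_dim] two_mult_witt_index flag_at_dim_Rad perp_Rad by simp

lemma nil_stab_perp_completion:
  assumes u: "u \<in> nil_stab F" and j: "j < dim UNIV"
  shows "u ` perp_completion F (Suc j) \<subseteq> perp_completion F j"
proof (cases "j < witt")
  case True
  then show ?thesis using u by (simp add: perp_completion_def nil_stab_def)
next
  case False
  let ?i = "2 * witt - Suc j"
  have i: "?i < witt" "Suc ?i = 2 * witt - j"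
    using False j two_mult_witt_index by linarith+
  then have "u ` F (Suc ?i) \<subseteq> F ?i" using u unfolding nil_stab_def by blast
  then have "u ` perp (F ?i) \<subseteq> perp (F (Suc ?i))"
    by (rule balt_image_perp_subset[OF nil_stab_balt[OF u]])
  then show ?thesis using False i(2) by (simp add: perp_completion_ge)
qed

lemma perp_completion_orthogonal:
  assumes ij: "i \<le> dim UNIV" "j \<le> dim UNIV" "i + j \<le> 2 * witt"
    and x: "x \<in> perp_completion F i" and y: "y \<in> perp_completion F j"
  shows "b x y = 0"
proof -
  have orthogonal: "b x y = 0"
    if i: "i \<le> witt" and j: "j \<le> dim UNIV" and ij: "i + j \<le> 2 * witt"
      and x: "x \<in> perp_completion F i" and y: "y \<in> perp_completion F j" for i j x y
  proof (cases "i \<le> dim (Rad b)")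
    case True
    then have "x \<in> Rad b" using x i flag_subset_Rad[of i] by (auto simp: perp_completion_def)
    then show ?thesis using b_eq_0_sym[of x y] by (simp add: Rad_def)
  next
    case False
    then have "2 * witt - i \<le> dim UNIV" using two_mult_witt_index by linarith
    moreover have "j \<le> 2 * witt - i" using ij by linarith
    ultimately have "y \<in> perp_completion F (2 * witt - i)"
      using partially_complete_flag_mono[OF perp_completion_flag] y by blast
    then have "y \<in> perp (F i)" using i perp_completion_ge[of "2 * witt - i"] by simp
    then show ?thesis using x i by (simp add: perp_def perp_completion_def)
  qed
  consider (left) "i \<le> witt" | (right) "j \<le> witt" using ij(3) by linarith
  then show ?thesis
  proof cases
    case left
    then show ?thesis using orthogonal ij x y by blast
  next
    case right
    then have "b y x = 0" using orthogonal[of j i y x] ij x y by (simp add: add.commute)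
    then show ?thesis using b_eq_0_sym by blast
  qed
qed

lemma nil_stab_nilpotent:
  assumes u: "u \<in> nil_stab F"
  shows "nilpotent_endo u"
proof -
  have "k \<le> dim UNIV \<Longrightarrow> x \<in> perp_completion F k \<Longrightarrow> (u ^^ k) x = 0" for k x
  proof (induction k arbitrary: x)
    case 0
    then show ?case using partially_complete_flag_0[OF perp_completion_flag] by simp
  next
    case (Suc k)
    then have "u x \<in> perp_completion F k" using nil_stab_perp_completion[OF u, of k] by auto
    then show ?case using Suc by (simp add: funpow_swap1)
  qed
  then have "u ^^ dim UNIV = (\<lambda>_. 0)" using perp_completion_dim_UNIV by blast
  then show ?thesis unfolding nilpotent_endo_def by blast
qed

lemma nil_stab_eq_nilpotent_stabilizers:
  "nil_stab F = {u. balt u \<and> nilpotent_endo u \<and> stabilizes_flag witt F u}"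
  using nil_stab_nilpotent nil_stab_stabilizes_flag nil_stab_of_nilpotent flag_partially_complete
    nil_stab_balt by blast

lemma span_adapted_basis:
  "adapted_basis (dim UNIV) (perp_completion F) e \<Longrightarrow> span (e ` {..<dim UNIV}) = UNIV"
  using perp_completion_dim_UNIV by (simp add: adapted_basis_def)

lemma nil_stab_adapted_basis:
  assumes "adapted_basis (dim UNIV) (perp_completion F) e" and "u \<in> nil_stab F" and "j < dim UNIV"
  shows "u (e j) \<in> perp_completion F j"
  using nil_stab_perp_completion[OF assms(2,3)] adapted_basis_mem[OF assms(1,3)] by blast

definition nil_stab_into_Rad :: "('v \<Rightarrow> 'v) set" where
  "nil_stab_into_Rad = {u \<in> nil_stab F. range u \<subseteq> Rad b}"

lemma subspace_nil_stab_into_Rad: "E.subspace nil_stab_into_Rad"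
  using subspace_nil_stab[OF flag_partially_complete] unfolding nil_stab_into_Rad_def
  by (auto simp: E.subspace_def fun_scale_def image_subset_iff
      subspace_0[OF subspace_Rad] subspace_add[OF subspace_Rad] subspace_scale[OF subspace_Rad])

lemma finite_dim_nil_stab_into_Rad: "finite_dim (fun_scale scale) nil_stab_into_Rad"
  by (rule E.finite_dim_subset[OF finite_dim_nil_stab]) (auto simp: nil_stab_into_Rad_def)

lemma nil_stab_into_Rad_eq_0:
  assumes e: "adapted_basis (dim UNIV) (perp_completion F) e" and u: "u \<in> nil_stab_into_Rad"
    and coords: "\<And>i j. j < dim UNIV \<Longrightarrow> i < min (dim (Rad b)) j \<Longrightarrow>
      representation (e ` {..<dim UNIV}) (u (e j)) (e i) = 0"
  shows "u = 0"
proof -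
  have u_nil_stab: "u \<in> nil_stab F" using u by (simp add: nil_stab_into_Rad_def)
  have "u (e j) = 0" if j: "j < dim UNIV" for j
  proof (rule eq_0_of_representation_adapted_basis[OF e])
    show "u (e j) \<in> perp_completion F (dim UNIV)" using perp_completion_dim_UNIV by simp
    fix i assume i: "i < dim UNIV"
    have in_chain: "u (e j) \<in> perp_completion F j"
      by (rule nil_stab_adapted_basis[OF e u_nil_stab j])
    have in_Rad: "u (e j) \<in> perp_completion F (dim (Rad b))"
      using u flag_at_dim_Rad dim_Rad_le_witt
      by (auto simp: nil_stab_into_Rad_def perp_completion_def)
    consider (counted) "i < min (dim (Rad b)) j" | (Rad) "dim (Rad b) \<le> i" | (chain) "j \<le> i"
      by linarith
    then show "representation (e ` {..<dim UNIV}) (u (e j)) (e i) = 0"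
      using coords[OF j] representation_adapted_basis_eq_0[OF e _ i in_Rad]
        representation_adapted_basis_eq_0[OF e _ i in_chain] by cases
  qed
  moreover have "lin u" by (rule nil_stab_lin[OF u_nil_stab])
  ultimately have "u x = 0" for x
    using endo.linear_eq_0_on_span[of u "e ` {..<dim UNIV}" x] span_adapted_basis[OF e] by auto
  then show ?thesis by auto
qed

lemma dim_nil_stab_into_Rad_le:
  "E.dim nil_stab_into_Rad \<le> (dim (Rad b) choose 2) + dim (Rad b) * (dim UNIV - dim (Rad b))"
proof -
  obtain e where e: "adapted_basis (dim UNIV) (perp_completion F) e"
    using adapted_basis_exists[OF perp_completion_flag] by blast
  let ?I = "SIGMA j:{..<dim UNIV}. {..<min (dim (Rad b)) j}"
  let ?coord = "\<lambda>(j, i) u. representation (e ` {..<dim UNIV}) (u (e j)) (e i)"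
  let ?kernel = "{u \<in> nil_stab_into_Rad. \<forall>t\<in>?I. ?coord t u = 0}"
  have "?kernel \<subseteq> {0}"
    by (auto intro!: nil_stab_into_Rad_eq_0[OF e, THEN fun_cong])
  then have "E.dim ?kernel = 0" using E.dim_le_card[of ?kernel "{}"] by simp
  moreover have "E.dim nil_stab_into_Rad \<le> card ?I + E.dim ?kernel"
  proof (rule E.dim_le_card_plus_dim_common_kernel)
    show "functional_on (fun_scale scale) nil_stab_into_Rad (?coord t)" for t
      using functional_on_evaluation[OF linear_representation] e span_adapted_basis[OF e]
      by (cases t) (simp add: adapted_basis_def)
  qed (use subspace_nil_stab_into_Rad finite_dim_nil_stab_into_Rad in auto)
  moreover have "card ?I = (dim (Rad b) choose 2) + dim (Rad b) * (dim UNIV - dim (Rad b))"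
    using sum_min_lessThan[OF dim_Rad_le_dim] by simp
  ultimately show ?thesis by simp
qed

lemma mem_nil_stab_into_Rad:
  assumes e: "adapted_basis (dim UNIV) (perp_completion F) e" and u: "u \<in> nil_stab F"
    and entries: "\<And>i j. i < j \<Longrightarrow> j < dim UNIV \<Longrightarrow> 2 * witt \<le> i + j \<Longrightarrow> b (u (e i)) (e j) = 0"
  shows "u \<in> nil_stab_into_Rad"
proof -
  note balt_u = nil_stab_balt[OF u]
  have above_diagonal: "b (u (e i)) (e j) = 0" if ij: "i < j" "j < dim UNIV" for i j
  proof (cases "2 * witt \<le> i + j")
    case False
    moreover have "u (e i) \<in> perp_completion F i" using nil_stab_adapted_basis[OF e u] ij by simp
    moreover have "e j \<in> perp_completion F (Suc j)" by (rule adapted_basis_mem[OF e ij(2)])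
    ultimately show ?thesis using perp_completion_orthogonal[of i "Suc j"] ij by simp
  qed (rule entries[OF ij])
  have "b (u (e i)) (e j) = 0" if "i < dim UNIV" "j < dim UNIV" for i j
  proof (cases i j rule: linorder_cases)
    case equal
    then show ?thesis using balt_u b_eq_0_sym by (auto simp: b_alternating_def)
  next
    case greater
    then have "b (u (e j)) (e i) = 0" using above_diagonal that by blast
    then show ?thesis using balt_adjoint[OF balt_u, of "e i" "e j"] b_eq_0_sym by metis
  qed (use above_diagonal that in blast)
  then have "e ` {..<dim UNIV} \<subseteq> perp {u (e i)}" if "i < dim UNIV" for i
    using that by (auto simp: perp_def)
  then have "UNIV \<subseteq> perp {u (e i)}" if "i < dim UNIV" for i
    using span_minimal[OF _ subspace_perp] span_adapted_basis[OF e] that by metis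
  then have "u (e i) \<in> Rad b" if "i < dim UNIV" for i
    using that b_eq_0_sym by (auto simp: perp_def Rad_def)
  then have "u ` span (e ` {..<dim UNIV}) \<subseteq> Rad b"
    unfolding endo.linear_span_image[OF nil_stab_lin[OF u], symmetric] by (intro span_minimal) auto
  then show ?thesis using u span_adapted_basis[OF e] by (simp add: nil_stab_into_Rad_def)
qed

lemma dim_nil_stab_le_modulo_Rad:
  "E.dim (nil_stab F) \<le> (witt - dim (Rad b)) * (witt - dim (Rad b) - 1) + E.dim nil_stab_into_Rad"
proof -
  obtain e where e: "adapted_basis (dim UNIV) (perp_completion F) e"
    using adapted_basis_exists[OF perp_completion_flag] by blast
  have dim_eq: "dim UNIV = witt + (witt - dim (Rad b))"
    using two_mult_witt_index dim_Rad_le_witt by linarith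
  let ?I = "SIGMA j:{..<dim UNIV}. {2 * witt - j..<j}"
  let ?entry = "\<lambda>(j, i) u. b (u (e i)) (e j)"
  let ?kernel = "{u \<in> nil_stab F. \<forall>t\<in>?I. ?entry t u = 0}"
  have subspace_N: "E.subspace (nil_stab F)" by (rule subspace_nil_stab[OF flag_partially_complete])
  have functionals: "functional_on (fun_scale scale) (nil_stab F) (?entry t)" for t
    using functional_on_evaluation[OF left.linear_axioms] by (cases t) simp
  have "?kernel \<subseteq> nil_stab_into_Rad"
    by (auto intro!: mem_nil_stab_into_Rad[OF e])
  moreover have "E.subspace ?kernel" by (rule E.subspace_common_kernel[OF subspace_N functionals])
  ultimately have "E.dim ?kernel \<le> E.dim nil_stab_into_Rad"
    using E.dim_subset_finite_dim[OF subspace_nil_stab_into_Rad finite_dim_nil_stab_into_Rad]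
    by blast
  moreover have "E.dim (nil_stab F) \<le> card ?I + E.dim ?kernel"
    using subspace_N finite_dim_nil_stab functionals
    by (intro E.dim_le_card_plus_dim_common_kernel) auto
  moreover have "card ?I \<le> (witt - dim (Rad b)) * (witt - dim (Rad b) - 1)"
    using sum_reflected_interval_lessThan[of witt "witt - dim (Rad b)"] dim_eq by simp
  ultimately show ?thesis by linarith
qed

lemma dim_nil_stab_le:
  "int (E.dim (nil_stab F)) \<le>
    int (dim (Rad b) choose 2) + int (dim UNIV - dim (Rad b)) * int (dim (Rad b))
    + (int witt - int (dim (Rad b))) * (int (dim UNIV) - int witt - 1)"
proof -
  let ?m = "witt - dim (Rad b)"
  have "int (?m * (?m - 1)) = int ?m * (int ?m - 1)" by (cases ?m) (auto simp: algebra_simps)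
  also have "\<dots> = (int witt - int (dim (Rad b))) * (int (dim UNIV) - int witt - 1)"
    using two_mult_witt_index dim_Rad_le_witt by (intro arg_cong2[where f = "(*)"]) linarith+
  finally show ?thesis
    using dim_nil_stab_le_modulo_Rad dim_nil_stab_into_Rad_le
    by (simp add: mult.commute flip: of_nat_mult of_nat_add)
qed

end

end

section \<open>Trace orthogonality to the stabilizer of a singular flag\<close>

context alternating_space
begin

definition skew_rank_two :: "'v \<Rightarrow> 'v \<Rightarrow> 'v \<Rightarrow> 'v" where
  "skew_rank_two x y w = b x w *s y - b y w *s x"

lemma balt_skew_rank_two: "balt (skew_rank_two x y)"
proof -
  have "lin (skew_rank_two x y)"
    by (rule linI) (simp_all add: skew_rank_two_def right.add right.scale algebra_simps)
  moreover have "b w (skew_rank_two x y w) = 0" for w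
    unfolding skew_rank_two_def right.diff right.scale using b_skew[of w x] b_skew[of w y] by simp
  ultimately show ?thesis by (simp add: b_alternating_def)
qed

lemma tr_skew_rank_two:
  assumes u: "balt u"
  shows "tr (skew_rank_two x y \<circ> u) = - 2 * b y (u x)"
proof -
  have linear: "Vector_Spaces.linear scale (*) (\<lambda>w. b z (u w))" for z
    using Vector_Spaces.linear_compose[OF balt_lin[OF u] right.linear_axioms]
    by (simp add: comp_def)
  have "skew_rank_two x y \<circ> u = (\<lambda>w. b x (u w) *s y) - (\<lambda>w. b y (u w) *s x)"
    by (simp add: fun_eq_iff skew_rank_two_def)
  then have "tr (skew_rank_two x y \<circ> u) = b x (u y) - b y (u x)"
    by (simp add: tr_diff tr_rank_one[OF linear])
  moreover have "b x (u y) = - b y (u x)"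
    using balt_adjoint[OF u, of x y] b_skew[of "u x" y] by simp
  ultimately show ?thesis by simp
qed

lemma balt_rank_one:
  assumes \<phi>: "Vector_Spaces.linear scale (*) \<phi>" and x: "x \<in> Rad b"
  shows "balt (\<lambda>w. \<phi> w *s x)"
proof -
  interpret \<phi>: Vector_Spaces.linear scale "(*)" \<phi> by fact
  have "lin (\<lambda>w. \<phi> w *s x)" by (rule linI) (simp_all add: \<phi>.add \<phi>.scale scale_left_distrib)
  then show ?thesis using x by (simp add: b_alternating_def right.scale Rad_def)
qed

context
  fixes F :: "nat \<Rightarrow> 'v set"
  assumes F: "maximal_singular_flag F"
begin

lemma flag_step_scale_mem:
  assumes "i \<le> witt" and "x \<in> F i" and "j < witt" and "w \<in> F (Suc j)"
    and vanish: "\<And>w. w \<in> F i \<Longrightarrow> f w = 0"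
  shows "f w *s x \<in> F j"
proof (cases "Suc j \<le> i")
  case True
  then have "f w = 0" using vanish flag_mono[OF F True] assms by blast
  then show ?thesis using subspace_0[OF subspace_flag[OF F]] assms(3) by simp
next
  case False
  then have "x \<in> F j" using flag_mono[OF F, of i j] assms by auto
  then show ?thesis using subspace_scale[OF subspace_flag[OF F]] assms(3) by simp
qed

lemma rank_one_mem_nil_stab:
  assumes \<phi>: "Vector_Spaces.linear scale (*) \<phi>" "\<And>w. w \<in> F i \<Longrightarrow> \<phi> w = 0"
    and i: "i \<le> witt" and x: "x \<in> F i" "x \<in> Rad b"
  shows "(\<lambda>w. \<phi> w *s x) \<in> nil_stab F"
  using balt_rank_one[OF \<phi>(1) x(2)] flag_step_scale_mem[OF i x(1) _ _ \<phi>(2)]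
  by (auto simp: nil_stab_def)

lemma skew_rank_two_mem_nil_stab:
  assumes i: "i \<le> witt" and x: "x \<in> F i" and y: "y \<in> perp (F i)"
  shows "skew_rank_two x y \<in> nil_stab F"
proof -
  have "skew_rank_two x y w \<in> F j" if j: "j < witt" and w: "w \<in> F (Suc j)" for j w
  proof -
    have "b x w = 0" using flag_orthogonal[OF F i, of "Suc j"] j x w by simp
    moreover have "b y w *s x \<in> F j"
      using y b_eq_0_sym by (intro flag_step_scale_mem[OF i x j w]) (auto simp: perp_def)
    ultimately show ?thesis
      using subspace_neg[OF subspace_flag[OF F]] j by (simp add: skew_rank_two_def)
  qed
  then show ?thesis using balt_skew_rank_two by (auto simp: nil_stab_def)
qed

context
  fixes u :: "'v \<Rightarrow> 'v"
  assumes u: "balt u" and orthogonal: "\<And>z. z \<in> nil_stab F \<Longrightarrow> tr (z \<circ> u) = 0"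
begin

lemma trace_orthogonal_stabilizes_in_Rad:
  assumes i: "i \<le> dim (Rad b)" and x: "x \<in> F i"
  shows "u x \<in> F i"
proof (rule ccontr)
  assume "u x \<notin> F i"
  moreover have i_witt: "i \<le> witt" using i dim_Rad_le_witt by simp
  ultimately obtain \<phi> where \<phi>: "Vector_Spaces.linear scale (*) \<phi>" "\<phi> (u x) = 1"
      "\<And>w. w \<in> F i \<Longrightarrow> \<phi> w = 0"
    using separating_functional_exists[OF subspace_flag[OF F]] by blast
  have "x \<in> Rad b" using flag_subset_Rad[OF F i] x by blast
  then have "tr ((\<lambda>w. \<phi> w *s x) \<circ> u) = 0"
    using orthogonal rank_one_mem_nil_stab[OF \<phi>(1,3) i_witt x] by blast
  moreover have "Vector_Spaces.linear scale (*) (\<phi> \<circ> u)"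
    using Vector_Spaces.linear_compose[OF balt_lin[OF u] \<phi>(1)] .
  ultimately show False using tr_rank_one[of "\<phi> \<circ> u" x] \<phi>(2) by (simp add: comp_def)
qed

lemma trace_orthogonal_stabilizes_above_Rad:
  assumes char: "(2::'k) \<noteq> 0" and i: "dim (Rad b) \<le> i" "i \<le> witt" and x: "x \<in> F i"
  shows "u x \<in> F i"
proof -
  have "b y (u x) = 0" if "y \<in> perp (F i)" for y
    using orthogonal[OF skew_rank_two_mem_nil_stab[OF i(2) x that]] tr_skew_rank_two[OF u] char
    by simp
  then have "u x \<in> perp (perp (F i))" by (simp add: perp_def)
  then show ?thesis using perp_perp[OF subspace_flag[OF F i(2)] Rad_subset_flag[OF F i]] by simp
qed

lemma trace_orthogonal_stabilizes_flag:
  assumes "(2::'k) \<noteq> 0"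
  shows "stabilizes_flag witt F u"
  unfolding stabilizes_flag_def
  using trace_orthogonal_stabilizes_in_Rad trace_orthogonal_stabilizes_above_Rad[OF assms]
  by (metis image_subsetI nat_le_linear)

end

end

section \<open>Large spaces of nilpotent alternating endomorphisms\<close>

lemma bilinear_on_tr_comp:
  assumes "\<And>z. z \<in> W \<Longrightarrow> lin z"
  shows "bilinear_on (fun_scale scale) (fun_scale scale) V W (\<lambda>u z. tr (z \<circ> u))"
proof -
  have "tr (z \<circ> (u + v)) = tr (z \<circ> u) + tr (z \<circ> v)"
    "tr (z \<circ> fun_scale scale c u) = c * tr (z \<circ> u)" if "z \<in> W" for z u v c
  proof -
    have "z \<circ> (u + v) = (z \<circ> u) + (z \<circ> v)" "z \<circ> fun_scale scale c u = fun_scale scale c (z \<circ> u)"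
      using endo.linear_add[OF assms[OF that]] endo.linear_scale[OF assms[OF that]]
      by (auto simp: fun_eq_iff fun_scale_def)
    then show "tr (z \<circ> (u + v)) = tr (z \<circ> u) + tr (z \<circ> v)"
      "tr (z \<circ> fun_scale scale c u) = c * tr (z \<circ> u)"
      by (simp_all add: tr_add tr_scale)
  qed
  moreover have "tr ((y + z) \<circ> u) = tr (y \<circ> u) + tr (z \<circ> u)"
    "tr (fun_scale scale c z \<circ> u) = c * tr (z \<circ> u)" for y z u c
    using tr_add[of "y \<circ> u" "z \<circ> u"] tr_scale[of c "z \<circ> u"]
    by (simp_all add: plus_fun_def fun_scale_def comp_def)
  ultimately show ?thesis by (simp add: bilinear_on_def functional_on_def)
qed

context
  fixes V :: "('v \<Rightarrow> 'v) set"
  assumes char: "(2::'k) \<noteq> 0"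
    and V: "E.subspace V" and balt: "\<And>u. u \<in> V \<Longrightarrow> balt u"
    and nil: "\<And>u. u \<in> V \<Longrightarrow> nilpotent_endo u"
begin

lemma tr_comp_nilpotent_space:
  assumes "u \<in> V" and "v \<in> V"
  shows "tr (u \<circ> v) = 0" and "tr (u \<circ> u \<circ> v) = 0"
  using assms tr_comp_nilpotent[OF char, of u v] balt_lin[OF balt] nil
    E.subspace_add[OF V] E.subspace_diff[OF V] by blast+

lemma trace_orthogonal_mem_of_dim_le:
  assumes F: "maximal_singular_flag F" and dim: "E.dim (nil_stab F) \<le> E.dim V"
    and z: "z \<in> nil_stab F" "\<And>u. u \<in> V \<Longrightarrow> tr (z \<circ> u) = 0"
  shows "z \<in> V"
proof -
  let ?N = "nil_stab F"
  have "u \<in> ?N" if u: "u \<in> V" "\<forall>z\<in>?N. tr (z \<circ> u) = 0" for u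
    using trace_orthogonal_stabilizes_flag[OF F balt[OF u(1)] _ char] u nil balt
    by (intro nil_stab_of_nilpotent[OF flag_partially_complete[OF F]]) auto
  then have "{u \<in> V. \<forall>z\<in>?N. tr (z \<circ> u) = 0} \<subseteq> {z \<in> ?N. \<forall>u\<in>V. tr (z \<circ> u) = 0}"
    using tr_comp_nilpotent_space(1) by blast
  then have "{z \<in> ?N. \<forall>u\<in>V. tr (z \<circ> u) = 0} \<subseteq> V"
    using V dim balt_lin[OF balt] nil_stab_lin
      subspace_nil_stab[OF flag_partially_complete[OF F]]
    by (intro E.right_kernel_subset_of_dim_le finite_dim_lin_subset finite_dim_nil_stab
        bilinear_on_tr_comp) auto
  then show ?thesis using z by blast
qed

context
  assumes large: "\<And>F. maximal_singular_flag F \<Longrightarrow> E.dim (nil_stab F) \<le> E.dim V"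
begin

lemma square_mem_of_large:
  assumes v: "v \<in> V"
  shows "v \<circ> v \<in> V"
proof -
  obtain F where F: "maximal_singular_flag F" and vF: "v \<in> nil_stab F"
    using maximal_singular_flag_exists[OF strictly_triangularizable_singleton[OF nil[OF v]]]
      balt[OF v] by auto
  have "lin (v \<circ> v)" using balt_lin[OF balt[OF v]] by (blast intro: Vector_Spaces.linear_compose)
  then have "balt (v \<circ> v)" using balt_adjoint[OF balt[OF v]] by (simp add: b_alternating_def)
  moreover have "(v \<circ> v) ` F (Suc i) \<subseteq> F i" if "i < witt" for i
  proof -
    have "v ` F i \<subseteq> F i" "v ` F (Suc i) \<subseteq> F i"
      using nil_stab_stabilizes_flag[OF flag_partially_complete[OF F] vF] vF that
      by (auto simp: stabilizes_flag_def nil_stab_def)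
    then show ?thesis by auto
  qed
  ultimately have "v \<circ> v \<in> nil_stab F" by (simp add: nil_stab_def)
  then show ?thesis
    using tr_comp_nilpotent_space(2)[OF v]
    by (intro trace_orthogonal_mem_of_dim_le[OF F large[OF F]])
qed

theorem large_nilpotent_space_eq_nil_stab: "\<exists>F. maximal_singular_flag F \<and> V = nil_stab F"
proof -
  have "strictly_triangularizable V"
    using V balt_lin[OF balt] nil square_mem_of_large
    by (rule strictly_triangularizable_of_square_mem)
  then obtain F where F: "maximal_singular_flag F" and "V \<subseteq> nil_stab F"
    using maximal_singular_flag_exists[OF _ balt] by blast
  then have "V = nil_stab F"
    using E.subspace_eq_of_dim_le[OF subspace_nil_stab[OF flag_partially_complete[OF F]]
        finite_dim_nil_stab V _ large[OF F]] by blast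
  then show ?thesis using F by blast
qed

end

end

end

theorem mainTheorem6:
  fixes scale :: "'k::field \<Rightarrow> 'v::ab_group_add \<Rightarrow> 'v"
    and Basis :: "'v set"
    and b :: "'v \<Rightarrow> 'v \<Rightarrow> 'k"
    and \<V> :: "('v \<Rightarrow> 'v) set"
    and n r \<nu> :: nat
  assumes fdvs: "finite_dimensional_vector_space scale Basis"
    and char: "(2::'k) \<noteq> 0"
    and n_def: "n = vector_space.dim scale (UNIV::'v set)"
    and bil: "bilinear_form scale b"
    and alt: "alternating_form b"
    and nu_def: "\<nu> = witt_index scale b"
    and r_def: "r = form_rank scale b"
    and sub: "module.subspace (fun_scale scale) \<V>"
    and inA: "\<forall>u\<in>\<V>. b_alternating scale b u"
    and nil: "\<forall>u\<in>\<V>. nilpotent_endo u"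
    and dimV: "int (vector_space.dim (fun_scale scale) \<V>)
               = int ((n - r) choose 2) + int r * int (n - r)
                 + (int \<nu> - int n + int r) * (int n - int \<nu> - 1)"
  shows "\<exists>F. partially_complete_flag scale \<nu> F \<and> totally_singular b (F \<nu>) \<and>
             F (n - r) = Rad b \<and>
             \<V> = {u. b_alternating scale b u \<and> nilpotent_endo u \<and> stabilizes_flag \<nu> F u}"
proof -
  interpret finite_dimensional_vector_space scale Basis by (rule fdvs)
  interpret alternating_space scale Basis b by unfold_locales (fact bil, fact alt)
  have rank: "n - dim (Rad b) = r" "n - r = dim (Rad b)"
    "int \<nu> - int n + int r = int \<nu> - int (dim (Rad b))"
    using dim_Rad_le_dim by (simp_all add: r_def form_rank_def n_def del: dim_UNIV)
  have "E.dim (nil_stab F) \<le> E.dim \<V>" if "maximal_singular_flag F" for F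
    using dim_nil_stab_le[OF that] dimV
    unfolding n_def[symmetric] nu_def[symmetric] rank by linarith
  then obtain F where F: "maximal_singular_flag F" "\<V> = nil_stab F"
    using large_nilpotent_space_eq_nil_stab[OF char sub] inA nil by blast
  then show ?thesis
    using nil_stab_eq_nilpotent_stabilizers[OF F(1)]
    unfolding maximal_singular_flag_def nu_def rank(2) by blast
qed

end
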